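(* Let $\psi:\mathbb{N}\to[0,1)$. Let $(A_n)_{n=1}^\infty$ be an admissible set system with parameter $\tau$ and let $(f_n)_{n=1}^\infty$ be the associated admissible function system (see context), so that each $f_n$ is supported on $A_n$ (mod $\mathbb{Z}^k$) and $0\le f_n\le1$. Then there is a constant $C=C_k>0$ such that, for all $n,n'\in\mathbb{N}$, \[ \lambda(f_nf_{n'}(\cdot+\boldsymbol\gamma))\le C\lambda(f_n)\lambda(f_{n'})+O\!\left(\min\Bigl\{\frac{\lambda(f_n)}{n^k},\frac{\lambda(f_{n'})}{(n')^k}\Bigr\}\gcd(n,n')^k\left(1+\frac{n^{\tau-1-1/k}+(n')^{\tau-1-1/k}}{\gcd(n,n')/(nn')}\right)^{k-1}\right), \] uniformly for all $\boldsymbol\gamma\in\mathbb{R}^k$.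
   Context: $\lambda(f)=\int_{[0,1]^k}f(\mathbf{x})\,d\mathbf{x}$; $\|\cdot\|$ is the distance to the nearest integer. Admissible systems: fix $\tau\in(0,1/k)$ and $\mathbf{y}\in\mathbb{R}^k$. For $m\in\mathbb{N}$ let $D_m=[2^{m-1},2^m)$. For each $m$ choose a finite index set $I_m$ and, for $i\in I_m$, $1\le j\le k$, numbers $d_{i,j}=d_{i,j,m}>0$ with $d_{i,j}\le1/(2n)$ and $n^{-(1+1/k+\tau)}\ll d_{i,j}\ll n^{-(1+1/k-\tau)}$ for all $n\in D_m$, such that $\prod_jd_{i,j}$ does not depend on $i$. To each $(i,j)$ associate $\mathcal{U}_{i,j}$ equal to $[0,nd_{i,j})$ ("first type") or $[nd_{i,j}/2,nd_{i,j})$ ("second type"). For $n\in D_m$ let $A_n=\bigcup_{i\in I_m}\{\mathbf{x}\in[0,1]^k:\|nx_j-y_j\|\in\mathcal{U}_{i,j}\ \forall j\}$, required to be a disjoint union and to satisfy Property $\mathcal{P}_n(\mathbf{y})$: modulo $\mathbb{Z}^k$, $A_n=\mathcal{Z}+n^{-1}(\mathbf{y}+\mathbb{Z}^k)$ for a strongly star-shaped $\mathcal{Z}\subseteq[-1/2,1/2]^k$ ($\mathbf{x}\in\mathcal{Z}$, $|z_j|\le|x_j|\ \forall j\Rightarrow\mathbf{z}\in\mathcal{Z}$). With non-zero smooth bump functions $\omega_1,\omega_2:\mathbb{R}\to[0,1]$ supported on $\{|x|<1\}$ and $\{1/2\le|x|<1\}$ respectively, put $b_{i,j}=\omega_1$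 for first type and $\omega_2$ for second type, and $f_n(\mathbf{x})=\sum_{i\in I_m}\sum_{\mathbf{a}\in\mathbb{Z}^k}\prod_jb_{i,j}\bigl((x_j-(a_j+y_j)/n)/d_{i,j}\bigr)$ for $n\in D_m$. The constant $C$ may depend on $k$ and on $\omega_1,\omega_2$. *)

theory Defs
  imports "HOL-Analysis.Analysis"
begin

definition smooth :: "(real \<Rightarrow> real) \<Rightarrow> bool" where
  "smooth f \<longleftrightarrow> (\<forall>r x. (deriv ^^ r) f differentiable (at x))"

definition bump_function :: "real set \<Rightarrow> (real \<Rightarrow> real) \<Rightarrow> bool" where
  "bump_function S \<omega> \<longleftrightarrow>
     smooth \<omega> \<and> (\<forall>t. 0 \<le> \<omega> t \<and> \<omega> t \<le> 1) \<and> (\<exists>t. \<omega> t \<noteq> 0) \<and> (\<forall>t. t \<notin> S \<longrightarrow> \<omega> t = 0)"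

definition dist_nearest_int :: "real \<Rightarrow> real" where
  "dist_nearest_int t = infdist t \<int>"

text \<open>The positive integers are partitioned into the blocks with index \<open>m \<ge> 1\<close>.\<close>

definition dyadic_block :: "nat \<Rightarrow> nat set" where
  "dyadic_block m = {2 ^ (m - 1)..<2 ^ m}"

definition block_index :: "nat \<Rightarrow> nat" where
  "block_index n = (THE m. 1 \<le> m \<and> n \<in> dyadic_block m)"

datatype interval_type = First_Type | Second_Type

text \<open>
  The raw data of a set system. The first argument of each field is the block index \<open>m\<close>,
  the second argument of the last two is an element \<open>i\<close> of the index set \<open>I\<^sub>m\<close>, and the third
  a coordinate \<open>j\<close>. Index sets are sets of natural numbers, which is no restriction as they
  will be finite.
\<close>

record 'k set_system =
  idx :: "nat \<Rightarrow> nat set"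
  width :: "nat \<Rightarrow> nat \<Rightarrow> 'k \<Rightarrow> real"
  kind :: "nat \<Rightarrow> nat \<Rightarrow> 'k \<Rightarrow> interval_type"

definition interval_of :: "interval_type \<Rightarrow> real \<Rightarrow> real set" where
  "interval_of T r = (case T of First_Type \<Rightarrow> {0..<r} | Second_Type \<Rightarrow> {r / 2..<r})"

definition box_set :: "real ^ 'k \<Rightarrow> 'k set_system \<Rightarrow> nat \<Rightarrow> nat \<Rightarrow> (real ^ 'k) set" where
  "box_set y S n i =
     {x \<in> cbox 0 1. \<forall>j. dist_nearest_int (real n * x $ j - y $ j)
        \<in> interval_of (kind S (block_index n) i j) (real n * width S (block_index n) i j)}"

definition A_set :: "real ^ 'k \<Rightarrow> 'k set_system \<Rightarrow> nat \<Rightarrow> (real ^ 'k) set" where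
  "A_set y S n = (\<Union>i\<in>idx S (block_index n). box_set y S n i)"

definition strongly_star_shaped :: "(real ^ 'k) set \<Rightarrow> bool" where
  "strongly_star_shaped Z \<longleftrightarrow> (\<forall>x\<in>Z. \<forall>z. (\<forall>j. \<bar>z $ j\<bar> \<le> \<bar>x $ j\<bar>) \<longrightarrow> z \<in> Z)"

definition int_vec :: "int ^ 'k \<Rightarrow> real ^ 'k" where
  "int_vec a = (\<chi> j. real_of_int (a $ j))"

text \<open>Equality modulo \<open>\<int>\<^sup>k\<close> is equality of the \<open>\<int>\<^sup>k\<close>-saturations; the right-hand side below is
  already invariant under \<open>\<int>\<^sup>k\<close>.\<close>

definition property_P :: "nat \<Rightarrow> real ^ 'k \<Rightarrow> (real ^ 'k) set \<Rightarrow> bool" where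
  "property_P n y A \<longleftrightarrow>
     (\<exists>Z. strongly_star_shaped Z \<and> (\<forall>z\<in>Z. \<forall>j. - 1 / 2 \<le> z $ j \<and> z $ j \<le> 1 / 2) \<and>
        {x + int_vec a | x a. x \<in> A} = {z + (1 / real n) *\<^sub>R (y + int_vec a) | z a. z \<in> Z})"

text \<open>The numbers \<open>c\<close>, \<open>c'\<close> are the implied constants in
  \<open>n powr -(1+1/k+\<tau>) \<lless> d \<lless> n powr -(1+1/k-\<tau>)\<close>; they do not depend on \<open>n\<close>, \<open>m\<close>, \<open>i\<close>, \<open>j\<close>.\<close>

definition admissible :: "real \<Rightarrow> real \<Rightarrow> real \<Rightarrow> real ^ 'k \<Rightarrow> 'k set_system \<Rightarrow> bool" where
  "admissible \<tau> c c' y S \<longleftrightarrow>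
     (\<forall>m\<ge>1.
        finite (idx S m) \<and>
        (\<forall>i\<in>idx S m. \<forall>j. 0 < width S m i j) \<and>
        (\<forall>n\<in>dyadic_block m. \<forall>i\<in>idx S m. \<forall>j.
           width S m i j \<le> 1 / (2 * real n) \<and>
           c * real n powr - (1 + 1 / real CARD('k) + \<tau>) \<le> width S m i j \<and>
           width S m i j \<le> c' * real n powr - (1 + 1 / real CARD('k) - \<tau>)) \<and>
        (\<forall>i\<in>idx S m. \<forall>i'\<in>idx S m. (\<Prod>j\<in>UNIV. width S m i j) = (\<Prod>j\<in>UNIV. width S m i' j)) \<and>
        (\<forall>n\<in>dyadic_block m.
           disjoint_family_on (box_set y S n) (idx S m) \<and> property_P n y (A_set y S n)))"

definition bump_of :: "(real \<Rightarrow> real) \<Rightarrow> (real \<Rightarrow> real) \<Rightarrow> interval_type \<Rightarrow> real \<Rightarrow> real" where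
  "bump_of \<omega>1 \<omega>2 T = (case T of First_Type \<Rightarrow> \<omega>1 | Second_Type \<Rightarrow> \<omega>2)"

text \<open>Each inner sum below has at most one non-zero term if \<open>S\<close> is admissible, so
  \<open>infsum\<close> is not used at a divergent sum.\<close>

definition f_fun ::
    "(real \<Rightarrow> real) \<Rightarrow> (real \<Rightarrow> real) \<Rightarrow> real ^ 'k \<Rightarrow> 'k set_system \<Rightarrow> nat \<Rightarrow> real ^ 'k \<Rightarrow> real" where
  "f_fun \<omega>1 \<omega>2 y S n x =
     (\<Sum>i\<in>idx S (block_index n). \<Sum>\<^sub>\<infinity>a\<in>(UNIV :: (int ^ 'k) set). \<Prod>j\<in>UNIV.
        bump_of \<omega>1 \<omega>2 (kind S (block_index n) i j)
          ((x $ j - (real_of_int (a $ j) + y $ j) / real n) / width S (block_index n) i j))"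

definition cube_integral :: "(real ^ 'k \<Rightarrow> real) \<Rightarrow> real" where
  "cube_integral f = (LINT x:cbox 0 1|lborel. f x)"

definition error_term :: "(real ^ 'k \<Rightarrow> real) \<Rightarrow> (real ^ 'k \<Rightarrow> real) \<Rightarrow> real \<Rightarrow> nat \<Rightarrow> nat \<Rightarrow> real" where
  "error_term f f' \<tau> n n' =
     min (cube_integral f / real n ^ CARD('k)) (cube_integral f' / real n' ^ CARD('k))
     * real (gcd n n') ^ CARD('k)
     * (1 + (real n powr (\<tau> - 1 - 1 / real CARD('k)) + real n' powr (\<tau> - 1 - 1 / real CARD('k)))
            / (real (gcd n n') / (real n * real n'))) ^ (CARD('k) - 1)"


subsection \<open>Basic properties of admissible systems\<close>

lemma block_index_unique:
  assumes "1 \<le> m" "n \<in> dyadic_block m"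
  shows "block_index n = m"
  unfolding block_index_def
proof (rule the_equality)
  fix m' assume m': "1 \<le> m' \<and> n \<in> dyadic_block m'"
  have "\<not> a < b" if "n \<in> dyadic_block a" "n \<in> dyadic_block b" for a b
  proof
    assume "a < b"
    hence "(2::nat) ^ a \<le> 2 ^ (b - 1)" by (intro power_increasing) auto
    moreover have "n < 2 ^ a" "2 ^ (b - 1) \<le> n" using that by (auto simp: dyadic_block_def)
    ultimately show False by linarith
  qed
  thus "m' = m" using m' assms by (meson linorder_neqE_nat)
qed (use assms in auto)

lemma block_index_mem:
  assumes "1 \<le> n"
  shows "1 \<le> block_index n" "n \<in> dyadic_block (block_index n)"
proof -
  define m where "m = (LEAST m. n < 2 ^ m)"
  have lt: "n < 2 ^ m" unfolding m_def by (rule LeastI[of _ n]) simp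
  have m: "1 \<le> m" using lt assms by (cases m) auto
  have "\<not> n < 2 ^ (m - 1)"
    using not_less_Least[of "m - 1" "\<lambda>m. n < 2 ^ m"] m by (simp add: m_def)
  hence mem: "n \<in> dyadic_block m" using lt by (simp add: dyadic_block_def)
  show "1 \<le> block_index n" "n \<in> dyadic_block (block_index n)"
    using block_index_unique[OF m mem] m mem by auto
qed

lemma dist_nearest_int_eq:
  assumes "\<bar>t - real_of_int a\<bar> \<le> 1 / 2"
  shows "dist_nearest_int t = \<bar>t - real_of_int a\<bar>"
proof -
  have "\<bar>t - real_of_int a\<bar> \<le> dist t b" if b: "b \<in> \<int>" for b :: real
  proof -
    from b obtain c where c: "b = real_of_int c" by (elim Ints_cases)
    show ?thesis
    proof (cases "c = a")
      case False
      hence "1 \<le> \<bar>real_of_int c - real_of_int a\<bar>" by linarith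
      thus ?thesis using assms unfolding c dist_real_def by linarith
    qed (simp add: c dist_real_def)
  qed
  hence "\<bar>t - real_of_int a\<bar> \<le> infdist t \<int>"
    by (subst infdist_notempty) (auto intro!: cINF_greatest Ints_0)
  moreover have "infdist t \<int> \<le> \<bar>t - real_of_int a\<bar>"
    using infdist_le[of "real_of_int a" \<int> t] by (simp add: dist_real_def)
  ultimately show ?thesis by (simp add: dist_nearest_int_def)
qed

context
  fixes \<omega>1 \<omega>2 :: "real \<Rightarrow> real" and \<tau> c c' :: real and y :: "real ^ 'k"
    and S :: "'k set_system" and n :: nat
  assumes bump1: "bump_function {t. \<bar>t\<bar> < 1} \<omega>1"
    and bump2: "bump_function {t. 1 / 2 \<le> \<bar>t\<bar> \<and> \<bar>t\<bar> < 1} \<omega>2"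
    and adm: "admissible \<tau> c c' y S" and n: "1 \<le> n"
begin

private abbreviation "M \<equiv> block_index n"
private abbreviation "T i x a \<equiv> (\<Prod>j\<in>UNIV. bump_of \<omega>1 \<omega>2 (kind S M i j)
   ((x $ j - (real_of_int (a $ j) + y $ j) / real n) / width S M i j))"

private lemma bump_le: "0 \<le> bump_of \<omega>1 \<omega>2 t u \<and> bump_of \<omega>1 \<omega>2 t u \<le> 1"
  using bump1 bump2 by (cases t) (auto simp: bump_of_def bump_function_def)

private lemma term_bounds: "0 \<le> T i x a \<and> T i x a \<le> 1"
  using bump_le by (auto intro: prod_nonneg prod_le_1)

private lemma width_bounds:
  assumes "i \<in> idx S M"
  shows "0 < width S M i j" "width S M i j \<le> 1 / (2 * real n)"
  using adm block_index_mem[OF n] assms unfolding admissible_def by blast+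

private lemma term_nonzero:
  assumes i: "i \<in> idx S M" and nz: "T i x a \<noteq> 0"
  shows "\<bar>real n * x $ j - y $ j - real_of_int (a $ j)\<bar>
           \<in> interval_of (kind S M i j) (real n * width S M i j)"
    and "\<bar>real n * x $ j - y $ j - real_of_int (a $ j)\<bar> < 1 / 2"
proof -
  let ?d = "width S M i j"
  let ?s = "real n * x $ j - y $ j - real_of_int (a $ j)"
  let ?u = "(x $ j - (real_of_int (a $ j) + y $ j) / real n) / ?d"
  have d: "0 < ?d" "?d \<le> 1 / (2 * real n)" using width_bounds[OF i] by auto
  have nd: "0 < real n * ?d" "real n * ?d \<le> 1 / 2"
    using d n by (auto simp: field_simps)
  have u: "\<bar>?s\<bar> = \<bar>?u\<bar> * (real n * ?d)"
  proof -
    have "?s = ?u * (real n * ?d)" using d n by (simp add: field_simps)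
    hence "\<bar>?s\<bar> = \<bar>?u\<bar> * \<bar>real n * ?d\<bar>" by (simp only: abs_mult)
    thus ?thesis using nd by linarith
  qed
  have "bump_of \<omega>1 \<omega>2 (kind S M i j) ?u \<noteq> 0" using nz by auto
  hence "\<bar>?u\<bar> < 1 \<and> (kind S M i j = Second_Type \<longrightarrow> 1 / 2 \<le> \<bar>?u\<bar>)"
    using bump1 bump2
    by (cases "kind S M i j") (auto simp: bump_of_def bump_function_def)
  hence "\<bar>?s\<bar> < 1 * (real n * ?d)"
    "kind S M i j = Second_Type \<longrightarrow> 1 / 2 * (real n * ?d) \<le> \<bar>?s\<bar>"
    unfolding u using nd by (meson mult_strict_right_mono mult_right_mono less_imp_le)+
  thus "\<bar>?s\<bar> \<in> interval_of (kind S M i j) (real n * ?d)" "\<bar>?s\<bar> < 1 / 2"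
    using nd by (auto simp: interval_of_def split: interval_type.splits)
qed

private lemma term_nonzero_box:
  assumes i: "i \<in> idx S M" and nz: "T i x a \<noteq> 0"
  shows "(\<chi> j. frac (x $ j)) \<in> box_set y S n i"
proof -
  have "dist_nearest_int (real n * frac (x $ j) - y $ j)
          = \<bar>real n * x $ j - y $ j - real_of_int (a $ j)\<bar>" for j
  proof -
    have "real n * frac (x $ j) - y $ j - real_of_int (a $ j - int n * \<lfloor>x $ j\<rfloor>)
        = real n * x $ j - y $ j - real_of_int (a $ j)"
      by (simp add: frac_def algebra_simps)
    thus ?thesis
      using dist_nearest_int_eq[of "real n * frac (x $ j) - y $ j" "a $ j - int n * \<lfloor>x $ j\<rfloor>"]
        term_nonzero(2)[OF i nz, of j] by linarith
  qed
  moreover have "(\<chi> j. frac (x $ j)) \<in> cbox 0 (1 :: real ^ 'k)"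
    by (auto simp: mem_box_cart intro: less_imp_le[OF frac_lt_1])
  ultimately show ?thesis
    using term_nonzero(1)[OF i nz] by (simp add: box_set_def)
qed

private lemma term_unique:
  assumes i: "i \<in> idx S M" "T i x a \<noteq> 0" and i': "i' \<in> idx S M" "T i' x a' \<noteq> 0"
  shows "i = i' \<and> a = a'"
proof -
  have "disjoint_family_on (box_set y S n) (idx S M)"
    using adm block_index_mem[OF n] unfolding admissible_def by blast
  hence "i = i'"
    using term_nonzero_box[OF i] term_nonzero_box[OF i'] i(1) i'(1)
    by (auto simp: disjoint_family_on_def)
  moreover have "a $ j = a' $ j" for j
    using term_nonzero(2)[OF i, of j] term_nonzero(2)[OF i', of j] by linarith
  ultimately show ?thesis by (simp add: vec_eq_iff)
qed

private lemma f_fun_cases: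
  "f_fun \<omega>1 \<omega>2 y S n x = 0 \<or>
   (\<exists>i a. i \<in> idx S M \<and> T i x a \<noteq> 0 \<and> f_fun \<omega>1 \<omega>2 y S n x = T i x a)"
proof (cases "\<exists>i a. i \<in> idx S M \<and> T i x a \<noteq> 0")
  case False
  hence "f_fun \<omega>1 \<omega>2 y S n x = (\<Sum>i\<in>idx S M. \<Sum>\<^sub>\<infinity>a\<in>(UNIV :: (int ^ 'k) set). 0)"
    unfolding f_fun_def by (intro sum.cong infsum_cong) auto
  thus ?thesis by simp
next
  case True
  then obtain i a where ia: "i \<in> idx S M" "T i x a \<noteq> 0" by blast
  have fin: "finite (idx S M)"
    using adm block_index_mem[OF n] unfolding admissible_def by blast
  have z: "T i' x a' = 0" if "i' \<in> idx S M" "i' \<noteq> i \<or> a' \<noteq> a" for i' a'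
    using term_unique[OF ia that(1), of a'] that(2) by blast
  have "f_fun \<omega>1 \<omega>2 y S n x = (\<Sum>i'\<in>idx S M. if i' = i then T i x a else 0)"
    unfolding f_fun_def
  proof (rule sum.cong)
    fix i' assume i': "i' \<in> idx S M"
    have "(\<Sum>\<^sub>\<infinity>a'\<in>(UNIV :: (int ^ 'k) set). T i' x a') = (\<Sum>\<^sub>\<infinity>a'\<in>{a}. T i' x a')"
      using z[OF i'] by (intro infsum_cong_neutral) auto
    also have "\<dots> = (if i' = i then T i x a else 0)"
      using z[OF i', of a] by auto
    finally show "(\<Sum>\<^sub>\<infinity>a'\<in>(UNIV :: (int ^ 'k) set). T i' x a') = (if i' = i then T i x a else 0)" .
  qed simp
  also have "\<dots> = T i x a" using fin ia(1) by simp
  finally show ?thesis using ia by blast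
qed

lemma f_fun_bounds: "0 \<le> f_fun \<omega>1 \<omega>2 y S n x" "f_fun \<omega>1 \<omega>2 y S n x \<le> 1"
proof -
  have "0 \<le> f_fun \<omega>1 \<omega>2 y S n x \<and> f_fun \<omega>1 \<omega>2 y S n x \<le> 1"
    using f_fun_cases[of x]
  proof (elim disjE exE conjE)
    fix i a assume "f_fun \<omega>1 \<omega>2 y S n x = T i x a"
    thus ?thesis using term_bounds[where i = i and x = x and a = a] by argo
  qed simp
  thus "0 \<le> f_fun \<omega>1 \<omega>2 y S n x" "f_fun \<omega>1 \<omega>2 y S n x \<le> 1" by auto
qed

lemma f_fun_support:
  assumes "f_fun \<omega>1 \<omega>2 y S n x \<noteq> 0"
  shows "(\<chi> j. frac (x $ j)) \<in> A_set y S n"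
proof -
  obtain i a where "i \<in> idx S M" "T i x a \<noteq> 0"
    using f_fun_cases[of x] assms by blast
  thus ?thesis using term_nonzero_box unfolding A_set_def by blast
qed

end

end

theory Submission
  imports Defs
begin

text \<open>
  Write \<open>g = gcd n n'\<close> and \<open>h = g / (n n')\<close>. Since \<open>f\<^sub>n\<close> is invariant under \<open>n\<^sup>-\<^sup>1 \<int>\<^sup>k\<close>, the correlation of
  \<open>f\<^sub>n\<close> and \<open>f\<^sub>n\<^sub>'\<close> does not change when \<open>f\<^sub>n\<^sub>'\<close> is averaged over the shifts by \<open>n\<^sup>-\<^sup>1 \<int>\<^sup>k\<close> modulo \<open>\<int>\<^sup>k\<close>. At
  each point, the number of these shifts at which \<open>f\<^sub>n\<^sub>'\<close> is non-zero is at most \<open>g\<^sup>k\<close> times the number of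
  points of a translate of \<open>h \<int>\<^sup>k\<close> in the central cell \<open>Z\<close> of \<open>A\<^sub>n\<^sub>'\<close>. As \<open>Z\<close> is strongly star-shaped, the
  points with all coordinates of size at least \<open>h\<close> own disjoint cubes of side \<open>h\<close> inside \<open>Z\<close>, so their
  number is at most \<open>h\<^sup>-\<^sup>k\<close> times the volume of \<open>Z\<close>; this gives the main term. The other points lie near
  a coordinate hyperplane and give the error term with \<open>\<lambda>(f\<^sub>n)\<close>. Translating by \<open>-\<gamma>\<close> exchanges the roles
  of \<open>n\<close> and \<open>n'\<close>, whence the minimum.
\<close>

section \<open>Lattice points in strongly star-shaped sets\<close>

lemma card_vec_box:
  fixes X :: "'k::finite \<Rightarrow> 'a set"
  assumes "\<And>j. finite (X j)"
  shows "finite {s :: 'a ^ 'k. \<forall>j. s $ j \<in> X j}"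
    and "card {s :: 'a ^ 'k. \<forall>j. s $ j \<in> X j} = (\<Prod>j\<in>UNIV. card (X j))"
proof -
  have bij: "bij_betw vec_nth {s :: 'a ^ 'k. \<forall>j. s $ j \<in> X j} (Pi\<^sub>E UNIV X)"
    by (rule bij_betw_byWitness[where f' = vec_lambda]) (auto simp: fun_eq_iff)
  have "finite (Pi\<^sub>E UNIV X)"
    using assms by (intro finite_PiE) auto
  then show "finite {s :: 'a ^ 'k. \<forall>j. s $ j \<in> X j}"
    using bij_betw_finite[OF bij] by simp
  show "card {s :: 'a ^ 'k. \<forall>j. s $ j \<in> X j} = (\<Prod>j\<in>UNIV. card (X j))"
    using bij_betw_same_card[OF bij] by (simp add: card_PiE)
qed

lemma card_int_between:
  fixes u v :: real
  assumes "u \<le> v"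
  shows "finite {s :: int. u < real_of_int s \<and> real_of_int s < v}"
    and "real (card {s :: int. u < real_of_int s \<and> real_of_int s < v}) \<le> v - u + 1"
proof -
  have sub: "{s :: int. u < real_of_int s \<and> real_of_int s < v} \<subseteq> {\<lfloor>u\<rfloor><..<\<lceil>v\<rceil>}"
    by (auto; linarith)
  then show "finite {s :: int. u < real_of_int s \<and> real_of_int s < v}"
    using finite_subset by blast
  have "card {s :: int. u < real_of_int s \<and> real_of_int s < v} \<le> nat (\<lceil>v\<rceil> - \<lfloor>u\<rfloor> - 1)"
    using card_mono[OF _ sub] by simp
  moreover have "real_of_int (\<lceil>v\<rceil> - \<lfloor>u\<rfloor> - 1) \<le> v - u + 1"
    by linarith
  moreover have "0 \<le> v - u + 1"
    using assms by simp
  ultimately show "real (card {s :: int. u < real_of_int s \<and> real_of_int s < v}) \<le> v - u + 1"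
    by linarith
qed

text \<open>The general bound, length plus one, would give three here. Two is correct because the
  interval is open at both ends.\<close>

lemma card_int_between_2:
  fixes u :: real
  shows "card {s :: int. u < real_of_int s \<and> real_of_int s < u + 2} \<le> 2"
proof -
  have sub: "{s :: int. u < real_of_int s \<and> real_of_int s < u + 2} \<subseteq> {\<lfloor>u\<rfloor> + 1, \<lfloor>u\<rfloor> + 2}"
    by (auto; linarith)
  have "card {s :: int. u < real_of_int s \<and> real_of_int s < u + 2} \<le> card {\<lfloor>u\<rfloor> + 1, \<lfloor>u\<rfloor> + 2}"
    by (rule card_mono[OF _ sub]) simp
  then show ?thesis
    by simp
qed

lemma emeasure_box_vec:
  fixes l u :: "real ^ 'k"
  assumes "\<And>j. l $ j \<le> u $ j"
  shows "emeasure lborel (box l u) = ennreal (\<Prod>j\<in>UNIV. u $ j - l $ j)"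
    and "emeasure lborel (cbox l u) = ennreal (\<Prod>j\<in>UNIV. u $ j - l $ j)"
proof -
  have le: "\<forall>b\<in>Basis. l \<bullet> b \<le> u \<bullet> b"
    using assms by (auto simp: Basis_vec_def inner_axis)
  have ne: "cbox l u \<noteq> {}"
    using le by (simp add: box_ne_empty)
  \<comment> \<open>Both products are the content of the same box; comparing them turns a product
    over \<open>Basis\<close> into one over coordinates.\<close>
  have "(\<Prod>b\<in>Basis. (u - l) \<bullet> b) = measure lborel (cbox l u)"
    using le by (simp add: measure_lborel_cbox_eq)
  also have "\<dots> = (\<Prod>j\<in>UNIV. u $ j - l $ j)"
    using content_cbox_cart[OF ne] by (simp add: measure_def)
  finally have eq: "(\<Prod>b\<in>Basis. (u - l) \<bullet> b) = (\<Prod>j\<in>UNIV. u $ j - l $ j)" .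
  show "emeasure lborel (box l u) = ennreal (\<Prod>j\<in>UNIV. u $ j - l $ j)"
    "emeasure lborel (cbox l u) = ennreal (\<Prod>j\<in>UNIV. u $ j - l $ j)"
    using le eq by (simp_all add: emeasure_lborel_box_eq emeasure_lborel_cbox_eq)
qed

lemma int_vec_nth [simp]: "int_vec a $ j = real_of_int (a $ j)"
  by (simp add: int_vec_def)

text \<open>Fix a coordinate \<open>j0\<close> in which the point has size below \<open>h\<close>.
  There \<open>s\<close> has at most two possible values, and in every other coordinate at most
  \<open>2 * D / h + 1\<close>. Summing over \<open>j0\<close> gives the factor
  \<open>CARD('k)\<close>.\<close>

lemma card_lattice_near_hyperplanes:
  fixes w :: "real ^ 'k"
  assumes h: "0 < h" and D: "0 \<le> D"
  shows "finite {s. (\<forall>j. \<bar>(w + h *\<^sub>R int_vec s) $ j\<bar> < D) \<and> (\<exists>j. \<bar>(w + h *\<^sub>R int_vec s) $ j\<bar> < h)}"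
    (is "finite ?P")
    and "real (card {s. (\<forall>j. \<bar>(w + h *\<^sub>R int_vec s) $ j\<bar> < D) \<and>
              (\<exists>j. \<bar>(w + h *\<^sub>R int_vec s) $ j\<bar> < h)})
          \<le> 2 * real CARD('k) * (2 * D / h + 1) ^ (CARD('k) - 1)"
proof -
  \<comment> \<open>\<open>T j\<close> and \<open>U j\<close> are the conditions of size below
    \<open>h\<close> and below \<open>D\<close> in coordinate \<open>j\<close>, solved for the
    integer \<open>s $ j\<close>.\<close>
  define T where "T j = {s :: int. - w $ j / h - 1 < real_of_int s \<and> real_of_int s < - w $ j / h - 1 + 2}" for j
  define U where "U j = {s :: int. - w $ j / h - D / h < real_of_int s \<and> real_of_int s < - w $ j / h + D / h}" for j
  define X where "X j0 j = (if j = j0 then T j else U j)" for j0 j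
  have T: "finite (T j)" "card (T j) \<le> 2" for j
    unfolding T_def by (intro card_int_between(1) card_int_between_2; simp)+
  have U: "finite (U j)" "real (card (U j)) \<le> 2 * D / h + 1" for j
    unfolding U_def using card_int_between[of "- w $ j / h - D / h" "- w $ j / h + D / h"] h D
    by auto
  have finX: "finite (X j0 j)" for j0 j
    using T U by (simp add: X_def)
  have sub: "?P \<subseteq> (\<Union>j0\<in>UNIV. {s. \<forall>j. s $ j \<in> X j0 j})"
  proof
    fix s assume "s \<in> ?P"
    then obtain j0 where j0: "\<bar>(w + h *\<^sub>R int_vec s) $ j0\<bar> < h"
      and all: "\<And>j. \<bar>(w + h *\<^sub>R int_vec s) $ j\<bar> < D" by blast
    have "s $ j \<in> X j0 j" for j
      using j0 all[of j] h unfolding X_def T_def U_def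
      by (auto simp: abs_less_iff field_simps)
    then show "s \<in> (\<Union>j0\<in>UNIV. {s. \<forall>j. s $ j \<in> X j0 j})" by blast
  qed
  have fin: "finite (\<Union>j0\<in>UNIV. {s. \<forall>j. s $ j \<in> X j0 j})"
    by (intro finite_UN_I card_vec_box(1) finX) simp
  then show "finite ?P"
    using sub finite_subset by blast
  have each: "real (card {s :: int ^ 'k. \<forall>j. s $ j \<in> X j0 j}) \<le> 2 * (2 * D / h + 1) ^ (CARD('k) - 1)" for j0
  proof -
    have "real (card {s :: int ^ 'k. \<forall>j. s $ j \<in> X j0 j}) = (\<Prod>j\<in>UNIV. real (card (X j0 j)))"
      using card_vec_box(2)[of "X j0", OF finX] by simp
    also have "\<dots> = real (card (T j0)) * (\<Prod>j\<in>UNIV - {j0}. real (card (X j0 j)))"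
      by (subst prod.remove[of _ j0]) (auto simp: X_def)
    also have "(\<Prod>j\<in>UNIV - {j0}. real (card (X j0 j))) \<le> (\<Prod>j\<in>UNIV - {j0}. 2 * D / h + 1)"
      by (rule prod_mono) (use U in \<open>auto simp: X_def\<close>)
    also have "(\<Prod>j\<in>UNIV - {j0}. 2 * D / h + 1) = (2 * D / h + 1) ^ (CARD('k) - 1)"
      by simp
    finally have "real (card {s :: int ^ 'k. \<forall>j. s $ j \<in> X j0 j})
        \<le> real (card (T j0)) * (2 * D / h + 1) ^ (CARD('k) - 1)"
      by (simp add: mult_left_mono)
    also have "\<dots> \<le> 2 * (2 * D / h + 1) ^ (CARD('k) - 1)"
      using T(2)[of j0] h D by (intro mult_right_mono) auto
    finally show ?thesis .
  qed
  have "real (card ?P) \<le> real (card (\<Union>j0\<in>UNIV. {s. \<forall>j. s $ j \<in> X j0 j}))"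
    using card_mono[OF fin sub] by simp
  also have "\<dots> \<le> real (\<Sum>j0\<in>UNIV. card {s :: int ^ 'k. \<forall>j. s $ j \<in> X j0 j})"
    by (intro of_nat_mono card_UN_le) simp
  also have "\<dots> \<le> (\<Sum>j0\<in>(UNIV :: 'k set). 2 * (2 * D / h + 1) ^ (CARD('k) - 1))"
    using each by (simp only: of_nat_sum) (intro sum_mono)
  finally show "real (card ?P) \<le> 2 * real CARD('k) * (2 * D / h + 1) ^ (CARD('k) - 1)"
    by simp
qed

text \<open>From each such point, moving by up to \<open>h\<close> towards the origin in every
  coordinate sweeps out an open cube, which star-shapedness keeps inside \<open>Z\<close>. These
  cubes are disjoint, so their total volume is at most that of \<open>Z\<close>. The measurable
  superset \<open>Y\<close> stands in for \<open>Z\<close>, whose measurability is not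
  assumed.\<close>

lemma card_lattice_off_hyperplanes:
  fixes w :: "real ^ 'k"
  assumes h: "0 < h" and star: "strongly_star_shaped Z"
    and Y: "Z \<subseteq> Y" "Y \<in> sets lborel" "emeasure lborel Y \<le> ennreal v" "0 \<le> v"
    and P: "finite P" "\<And>s. s \<in> P \<Longrightarrow> w + h *\<^sub>R int_vec s \<in> Z \<and> (\<forall>j. h \<le> \<bar>(w + h *\<^sub>R int_vec s) $ j\<bar>)"
  shows "real (card P) * h ^ CARD('k) \<le> v"
proof -
  define z where "z s = w + h *\<^sub>R int_vec s" for s
  \<comment> \<open>The cell of side \<open>h\<close> having the lattice point as its corner farthest from the origin\<close>
  define lo where "lo s = (\<chi> j. if 0 < z s $ j then z s $ j - h else z s $ j)" for s
  define Q where "Q s = box (lo s) (\<chi> j. lo s $ j + h)" for s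
  have "Q s \<inter> Q t = {}" if st: "s \<in> P" "t \<in> P" "s \<noteq> t" for s t
  proof -
    obtain j where j: "s $ j \<noteq> t $ j"
      using st by (auto simp: vec_eq_iff)
    have "h * 1 \<le> h * \<bar>real_of_int (s $ j) - real_of_int (t $ j)\<bar>"
      using j h by (intro mult_left_mono) linarith+
    also have "\<dots> = \<bar>z s $ j - z t $ j\<bar>"
      using h by (simp add: z_def abs_mult flip: right_diff_distrib)
    finally have "h \<le> \<bar>z s $ j - z t $ j\<bar>" by simp
    moreover have "h \<le> \<bar>z s $ j\<bar>" "h \<le> \<bar>z t $ j\<bar>"
      using P(2) st unfolding z_def by blast+
    \<comment> \<open>If the two coordinates have the same sign, both cells extend in the same
      direction and stay \<open>h\<close> apart at their corners; if the signs differ, the origin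
      separates them.\<close>
    ultimately have "lo s $ j + h \<le> lo t $ j \<or> lo t $ j + h \<le> lo s $ j"
      using h by (auto simp: lo_def)
    moreover have "lo s $ j < x $ j \<and> x $ j < lo s $ j + h" if "x \<in> Q s" for x s
      using that by (auto simp: Q_def mem_box_cart)
    ultimately show ?thesis
      by (smt (verit) disjoint_iff)
  qed
  then have disj: "disjoint_family_on Q P"
    by (auto simp: disjoint_family_on_def)
  have sub: "Q s \<subseteq> Z" if s: "s \<in> P" for s
  proof
    fix x assume "x \<in> Q s"
    then have x: "lo s $ j < x $ j" "x $ j < lo s $ j + h" for j
      by (auto simp: Q_def mem_box_cart)
    have "\<bar>x $ j\<bar> \<le> \<bar>z s $ j\<bar>" for j
    proof -
      have "h \<le> \<bar>z s $ j\<bar>" using P(2)[OF s] by (auto simp: z_def)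
      then show ?thesis using x[of j] h by (auto simp: lo_def split: if_splits)
    qed
    moreover have "z s \<in> Z" using P(2)[OF s] by (simp add: z_def)
    ultimately show "x \<in> Z" using star unfolding strongly_star_shaped_def by blast
  qed
  have "(\<Sum>s\<in>P. emeasure lborel (Q s)) = emeasure lborel (\<Union>s\<in>P. Q s)"
    by (rule sum_emeasure[OF _ disj P(1)]) (auto simp: Q_def)
  also have "\<dots> \<le> emeasure lborel Y"
    using sub Y by (intro emeasure_mono) auto
  also have "\<dots> \<le> ennreal v" by fact
  finally have "(\<Sum>s\<in>P. emeasure lborel (Q s)) \<le> ennreal v" .
  moreover have "emeasure lborel (Q s) = ennreal (h ^ CARD('k))" for s
    unfolding Q_def using h by (subst emeasure_box_vec) auto
  ultimately have "ennreal (real (card P) * h ^ CARD('k)) \<le> ennreal v"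
    using h by (simp add: ennreal_mult'' ennreal_of_nat_eq_real_of_nat)
  then show ?thesis using Y by simp
qed

text \<open>The points of \<open>Z\<close> are split according to whether some coordinate is smaller
  than \<open>h\<close>. Comparison of volumes bounds the points without such a coordinate, and the
  count near coordinate hyperplanes bounds the others.\<close>

lemma card_lattice_star_shaped:
  fixes w :: "real ^ 'k"
  assumes h: "0 < h" and D: "0 \<le> D" and star: "strongly_star_shaped Z"
    and Z: "\<And>z j. z \<in> Z \<Longrightarrow> \<bar>z $ j\<bar> < D"
    and Y: "Z \<subseteq> Y" "Y \<in> sets lborel" "emeasure lborel Y \<le> ennreal v" "0 \<le> v"
  shows "finite {s. w + h *\<^sub>R int_vec s \<in> Z}"
    and "real (card {s. w + h *\<^sub>R int_vec s \<in> Z})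
         \<le> v / h ^ CARD('k) + 2 * real CARD('k) * (2 * D / h + 1) ^ (CARD('k) - 1)"
proof -
  let ?z = "\<lambda>s. w + h *\<^sub>R int_vec s"
  let ?near = "{s. (\<forall>j. \<bar>?z s $ j\<bar> < D) \<and> (\<exists>j. \<bar>?z s $ j\<bar> < h)}"
  let ?off = "{s. ?z s \<in> Z \<and> (\<forall>j. h \<le> \<bar>?z s $ j\<bar>)}"
  have "finite {s :: int ^ 'k. \<forall>j. s $ j \<in> {s. - w $ j / h - D / h < real_of_int s \<and> real_of_int s < - w $ j / h + D / h}}"
    using card_int_between(1) h D by (intro card_vec_box(1)) auto
  moreover have "{s. ?z s \<in> Z} \<subseteq> {s :: int ^ 'k. \<forall>j. s $ j \<in> {s. - w $ j / h - D / h < real_of_int s \<and> real_of_int s < - w $ j / h + D / h}}"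
  proof
    fix s assume "s \<in> {s. ?z s \<in> Z}"
    then have "\<bar>?z s $ j\<bar> < D" for j using Z by blast
    then have "- w $ j / h - D / h < real_of_int (s $ j) \<and> real_of_int (s $ j) < - w $ j / h + D / h" for j
      using h by (force simp: abs_less_iff field_simps)
    then show "s \<in> {s :: int ^ 'k. \<forall>j. s $ j \<in> {s. - w $ j / h - D / h < real_of_int s \<and> real_of_int s < - w $ j / h + D / h}}"
      by simp
  qed
  ultimately show fin: "finite {s. ?z s \<in> Z}"
    using finite_subset by blast
  have "{s. ?z s \<in> Z} \<subseteq> ?off \<union> ?near"
    using Z by (fastforce simp: not_le)
  then have "card {s. ?z s \<in> Z} \<le> card (?off \<union> ?near)"
    using fin card_lattice_near_hyperplanes(1)[OF h D, of w]
    by (intro card_mono) (auto elim: finite_subset[rotated])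
  also have "\<dots> \<le> card ?off + card ?near"
    by (rule card_Un_le)
  finally have "real (card {s. ?z s \<in> Z}) \<le> real (card ?off) + real (card ?near)"
    by linarith
  moreover have "real (card ?off) * h ^ CARD('k) \<le> v"
    using fin by (intro card_lattice_off_hyperplanes[OF h star Y, of _ w]) (auto elim: finite_subset[rotated])
  then have "real (card ?off) \<le> v / h ^ CARD('k)"
    using h by (simp add: field_simps)
  ultimately show "real (card {s. ?z s \<in> Z})
         \<le> v / h ^ CARD('k) + 2 * real CARD('k) * (2 * D / h + 1) ^ (CARD('k) - 1)"
    using card_lattice_near_hyperplanes(2)[OF h D, of w] by linarith
qed

text \<open>With \<open>n = N * g\<close> and \<open>n' = N' * g\<close>, the difference r/n - b/n'
  equals h * (N' r - N b), where h = g/(n n'). So every counted \<open>r\<close> leads to a lattice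
  point \<open>s = N' r - N b\<close>. As \<open>N\<close> and \<open>N'\<close> are coprime,
  \<open>s\<close> determines \<open>r\<close> modulo \<open>N\<close>, which leaves at most
  \<open>g\<close> choices per coordinate.\<close>

lemma card_rational_shifts:
  fixes w :: "real ^ 'k"
  assumes n: "0 < n" "0 < n'"
    and P: "finite {s. w + (real (gcd n n') / (real n * real n')) *\<^sub>R int_vec s \<in> Z}" (is "finite ?P")
  shows "card {r :: int ^ 'k. (\<forall>j. r $ j \<in> {0..<int n}) \<and>
           (\<exists>b. w + (1 / real n) *\<^sub>R int_vec r - (1 / real n') *\<^sub>R int_vec b \<in> Z)}
         \<le> card {s. w + (real (gcd n n') / (real n * real n')) *\<^sub>R int_vec s \<in> Z} * gcd n n' ^ CARD('k)"
    (is "card ?R \<le> card ?P * _")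
proof -
  define g where "g = gcd n n'"
  obtain N N' where N: "n = N * g" "n' = N' * g" and cop: "coprime N N'"
    unfolding g_def using n gcd_coprime_exists[of n n'] by auto
  have pos: "0 < g" "0 < N" "0 < N'" using n N by (auto intro: Nat.gr0I)
  have "\<forall>r\<in>?R. \<exists>b. w + (1 / real n) *\<^sub>R int_vec r - (1 / real n') *\<^sub>R int_vec b \<in> Z"
    by blast
  then obtain b where b: "\<And>r. r \<in> ?R \<Longrightarrow> w + (1 / real n) *\<^sub>R int_vec r - (1 / real n') *\<^sub>R int_vec (b r) \<in> Z"
    by (metis (no_types, lifting))
  define s :: "int ^ 'k \<Rightarrow> int ^ 'k" where "s r = (\<chi> j. int N' * r $ j - int N * b r $ j)" for r
  \<comment> \<open>The quotient by \<open>N\<close> takes one of \<open>g\<close> values in each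
    coordinate; with the residue modulo \<open>N\<close>, known from \<open>s\<close>, it recovers
    \<open>r\<close>.\<close>
  define q :: "int ^ 'k \<Rightarrow> int ^ 'k" where "q r = (\<chi> j. r $ j div int N)" for r
  define G where "G = {q :: int ^ 'k. \<forall>j. q $ j \<in> {0..<int g}}"
  have G: "finite G" "card G = g ^ CARD('k)"
    unfolding G_def using card_vec_box[of "\<lambda>_. {0..<int g}"] by auto
  have "(real g / (real n * real n')) *\<^sub>R int_vec (s r)
      = (1 / real n) *\<^sub>R int_vec r - (1 / real n') *\<^sub>R int_vec (b r)" for r
    using pos by (simp add: vec_eq_iff s_def N field_simps)
  then have "w + (real g / (real n * real n')) *\<^sub>R int_vec (s r) \<in> Z" if "r \<in> ?R" for r
    using b[OF that] by (simp add: add_diff_eq)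
  moreover have "q r \<in> G" if "r \<in> ?R" for r
  proof -
    have "r $ j div int N < int g" if "0 \<le> r $ j" "r $ j < int n" for j
    proof -
      have "int N * (r $ j div int N) \<le> r $ j"
        using mult_div_mod_eq[of "int N" "r $ j"] pos_mod_sign[of "int N" "r $ j"] pos by linarith
      also have "\<dots> < int N * int g"
        using that N by simp
      finally show ?thesis using pos by simp
    qed
    then show ?thesis using that pos by (auto simp: q_def G_def pos_imp_zdiv_nonneg_iff)
  qed
  ultimately have img: "(\<lambda>r. (s r, q r)) ` ?R \<subseteq> ?P \<times> G"
    by (auto simp: g_def)
  have inj: "inj_on (\<lambda>r. (s r, q r)) ?R"
  proof (rule inj_onI)
    fix r r' assume "r \<in> ?R" "r' \<in> ?R" and eq: "(s r, q r) = (s r', q r')"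
    have "r $ j = r' $ j" for j
    proof -
      have "int N' * r $ j - int N * b r $ j = int N' * r' $ j - int N * b r' $ j"
        using eq by (simp add: s_def vec_eq_iff)
      then have "int N' * (r $ j - r' $ j) = int N * (b r $ j - b r' $ j)"
        by (simp add: algebra_simps)
      then have "int N dvd int N' * (r $ j - r' $ j)" by simp
      then have "int N dvd r $ j - r' $ j"
        using cop by (simp add: coprime_dvd_mult_right_iff)
      then have "r $ j mod int N = r' $ j mod int N"
        by (simp add: mod_eq_dvd_iff)
      moreover have "r $ j div int N = r' $ j div int N"
        using eq by (simp add: q_def vec_eq_iff)
      ultimately show ?thesis
        by (metis mult_div_mod_eq)
    qed
    then show "r = r'" by (simp add: vec_eq_iff)
  qed
  have "card ?R \<le> card (?P \<times> G)"
    using card_inj_on_le[OF inj img] P G by simp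
  then show ?thesis using G by (simp add: card_cartesian_product g_def)
qed

section \<open>Integrals of periodic functions\<close>

text \<open>Half-open sides let the cubes of side 1/n tile space without overlap, so that lattice
  translates can be counted exactly.\<close>

definition half_open_cube :: "real ^ 'k \<Rightarrow> real \<Rightarrow> (real ^ 'k) set" where
  "half_open_cube w s = {x. \<forall>j. w $ j \<le> x $ j \<and> x $ j < w $ j + s}"

lemma measurable_vec_nth_borel [measurable]: "(\<lambda>x :: real ^ 'k. x $ j) \<in> borel_measurable borel"
  by (intro borel_measurable_continuous_onI continuous_intros)

lemma half_open_cube_measurable [measurable]: "half_open_cube w s \<in> sets borel"
  unfolding half_open_cube_def by measurable

lemma nn_integral_lborel_shift:
  fixes G :: "real ^ 'k \<Rightarrow> ennreal"
  assumes [measurable]: "G \<in> borel_measurable borel"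
  shows "(\<integral>\<^sup>+x. G (x + v) \<partial>lborel) = (\<integral>\<^sup>+x. G x \<partial>lborel)"
proof -
  have "(\<integral>\<^sup>+x. G x \<partial>lborel) = (\<integral>\<^sup>+x. G x \<partial>distr lborel borel ((+) v))"
    by (simp only: lborel_distr_plus)
  also have "\<dots> = (\<integral>\<^sup>+x. G (v + x) \<partial>lborel)"
    by (rule nn_integral_distr) auto
  finally show ?thesis by (simp add: add.commute)
qed

text \<open>Coordinatewise, the condition on \<open>a\<close> places it in a half-open interval of
  length \<open>m\<close>, which contains exactly \<open>m\<close> integers. The count is written as
  an integral over \<open>count_space\<close> so that it can be interchanged with the Lebesgue
  integral.\<close>

lemma nn_integral_count_half_open_cube:
  fixes x w :: "real ^ 'k"
  assumes n: "0 < n"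
  shows "(\<integral>\<^sup>+a. indicator (half_open_cube w (real m / real n)) (x + (1 / real n) *\<^sub>R int_vec a) \<partial>count_space UNIV)
    = of_nat (m ^ CARD('k))" (is "?l x = _")
    and "(\<integral>\<^sup>+a. indicator (half_open_cube w (real m / real n)) (x - (1 / real n) *\<^sub>R int_vec a) \<partial>count_space UNIV)
    = of_nat (m ^ CARD('k))"
proof -
  define u where "u j = real n * (w $ j - x $ j)" for j
  define X where "X j = {\<lceil>u j\<rceil>..<\<lceil>u j\<rceil> + int m}" for j
  have fin: "finite (X j)" for j by (simp add: X_def)
  have "x + (1 / real n) *\<^sub>R int_vec a \<in> half_open_cube w (real m / real n) \<longleftrightarrow> (\<forall>j. a $ j \<in> X j)" for a
  proof -
    have "w $ j \<le> x $ j + real_of_int (a $ j) / real n \<and>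
          x $ j + real_of_int (a $ j) / real n < w $ j + real m / real n \<longleftrightarrow> a $ j \<in> X j" for j
    proof -
      have "w $ j \<le> x $ j + real_of_int (a $ j) / real n \<longleftrightarrow> u j \<le> real_of_int (a $ j)"
        using n by (simp add: u_def field_simps)
      moreover have "x $ j + real_of_int (a $ j) / real n < w $ j + real m / real n \<longleftrightarrow> real_of_int (a $ j - int m) < u j"
      proof -
        have "real n * (x $ j + real_of_int (a $ j) / real n) = real n * x $ j + real_of_int (a $ j)"
          "real n * (w $ j + real m / real n) = real n * w $ j + real m"
          using n by (simp_all add: field_simps)
        moreover have "x $ j + real_of_int (a $ j) / real n < w $ j + real m / real n \<longleftrightarrow>
            real n * (x $ j + real_of_int (a $ j) / real n) < real n * (w $ j + real m / real n)"
          using n by simp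
        ultimately show ?thesis
          by (simp add: u_def algebra_simps)
      qed
      ultimately show ?thesis
        unfolding X_def using ceiling_le_iff[of "u j" "a $ j"] less_ceiling_iff[of "a $ j - int m" "u j"]
        by auto
    qed
    then show ?thesis by (simp add: half_open_cube_def)
  qed
  then have ind: "indicator (half_open_cube w (real m / real n)) (x + (1 / real n) *\<^sub>R int_vec a)
      = (indicator {a. \<forall>j. a $ j \<in> X j} a :: ennreal)" for a
    by (simp add: indicator_def)
  have "?l x = emeasure (count_space UNIV) {a. \<forall>j. a $ j \<in> X j}"
    unfolding ind by simp
  also have "\<dots> = of_nat (card {a :: int ^ 'k. \<forall>j. a $ j \<in> X j})"
    using card_vec_box(1)[OF fin] by (intro emeasure_count_space_finite) auto
  also have "card {a :: int ^ 'k. \<forall>j. a $ j \<in> X j} = m ^ CARD('k)"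
    using card_vec_box(2)[OF fin] by (simp add: X_def)
  finally show plus: "?l x = of_nat (m ^ CARD('k))" .
  have "bij_betw uminus (UNIV :: (int ^ 'k) set) UNIV"
    by (rule bij_betw_byWitness[where f' = uminus]) auto
  from nn_integral_bij_count_space[OF this, of "\<lambda>a. indicator (half_open_cube w (real m / real n)) (x + (1 / real n) *\<^sub>R int_vec a)"]
  have "?l x = (\<integral>\<^sup>+a. indicator (half_open_cube w (real m / real n)) (x + (1 / real n) *\<^sub>R int_vec (- a)) \<partial>count_space UNIV)"
    by simp
  moreover have "int_vec (- a) = - int_vec a" for a :: "int ^ 'k"
    by (simp add: vec_eq_iff)
  ultimately show "(\<integral>\<^sup>+a. indicator (half_open_cube w (real m / real n)) (x - (1 / real n) *\<^sub>R int_vec a) \<partial>count_space UNIV)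
    = of_nat (m ^ CARD('k))"
    using plus by simp
qed

text \<open>Both sides equal the integral over \<open>x\<close> of
  \<open>\<Sum>a. indicator Q x * indicator Q' (x + a / n) * F x\<close>, where the two cubes \<open>Q\<close>, \<open>Q'\<close> cover each
  class modulo \<open>n\<^sup>-\<^sup>1 \<int>\<^sup>k\<close> exactly \<open>m\<^sup>k\<close> and \<open>m'\<^sup>k\<close> times.\<close>

lemma nn_integral_periodic_cubes:
  fixes F :: "real ^ 'k \<Rightarrow> ennreal"
  assumes n: "0 < n" and F [measurable]: "F \<in> borel_measurable borel"
    and per: "\<And>x a. F (x + (1 / real n) *\<^sub>R int_vec a) = F x"
  shows "of_nat (m' ^ CARD('k)) * (\<integral>\<^sup>+x\<in>half_open_cube w (real m / real n). F x \<partial>lborel)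
       = of_nat (m ^ CARD('k)) * (\<integral>\<^sup>+x\<in>half_open_cube w' (real m' / real n). F x \<partial>lborel)"
proof -
  define Q where "Q = half_open_cube w (real m / real n)"
  define Q' where "Q' = half_open_cube w' (real m' / real n)"
  have [measurable]: "Q \<in> sets borel" "Q' \<in> sets borel"
    by (auto simp: Q_def Q'_def)
  define t where "t a = (1 / real n) *\<^sub>R int_vec a" for a :: "int ^ 'k"
  have "of_nat (m' ^ CARD('k)) * (\<integral>\<^sup>+x\<in>Q. F x \<partial>lborel)
      = (\<integral>\<^sup>+x. (F x * indicator Q x) * of_nat (m' ^ CARD('k)) \<partial>lborel)"
    by (subst mult.commute, subst nn_integral_multc) auto
  also have "\<dots> = (\<integral>\<^sup>+x. (F x * indicator Q x) * (\<integral>\<^sup>+a. indicator Q' (x + t a) \<partial>count_space UNIV) \<partial>lborel)"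
    using nn_integral_count_half_open_cube(1)[OF n, of w' m'] by (simp add: Q'_def t_def)
  also have "\<dots> = (\<integral>\<^sup>+x. (\<integral>\<^sup>+a. (F x * indicator Q x) * indicator Q' (x + t a) \<partial>count_space UNIV) \<partial>lborel)"
    by (simp add: nn_integral_cmult)
  also have "\<dots> = (\<integral>\<^sup>+a. (\<integral>\<^sup>+x. (F x * indicator Q x) * indicator Q' (x + t a) \<partial>lborel) \<partial>count_space UNIV)"
    by (rule nn_integral_count_space_nn_integral) auto
  \<comment> \<open>Substituting \<open>x - t a\<close> for \<open>x\<close> moves the shift from
    \<open>Q'\<close> to \<open>Q\<close>, while periodicity leaves \<open>F\<close>
    unchanged.\<close>
  also have "\<dots> = (\<integral>\<^sup>+a. (\<integral>\<^sup>+x. (F x * indicator Q' x) * indicator Q (x - t a) \<partial>lborel) \<partial>count_space UNIV)"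
  proof (rule nn_integral_cong)
    fix a :: "int ^ 'k"
    have "(\<integral>\<^sup>+x. (F x * indicator Q' x) * indicator Q (x - t a) \<partial>lborel)
        = (\<integral>\<^sup>+x. (F (x + t a) * indicator Q' (x + t a)) * indicator Q (x + t a - t a) \<partial>lborel)"
      by (rule nn_integral_lborel_shift[symmetric]) measurable
    also have "\<dots> = (\<integral>\<^sup>+x. (F x * indicator Q x) * indicator Q' (x + t a) \<partial>lborel)"
      by (intro nn_integral_cong) (auto simp: t_def per ac_simps)
    finally show "(\<integral>\<^sup>+x. (F x * indicator Q x) * indicator Q' (x + t a) \<partial>lborel)
      = (\<integral>\<^sup>+x. (F x * indicator Q' x) * indicator Q (x - t a) \<partial>lborel)" ..
  qed
  also have "\<dots> = (\<integral>\<^sup>+x. (\<integral>\<^sup>+a. (F x * indicator Q' x) * indicator Q (x - t a) \<partial>count_space UNIV) \<partial>lborel)"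
    by (rule nn_integral_count_space_nn_integral[symmetric]) auto
  also have "\<dots> = (\<integral>\<^sup>+x. (F x * indicator Q' x) * (\<integral>\<^sup>+a. indicator Q (x - t a) \<partial>count_space UNIV) \<partial>lborel)"
    by (simp add: nn_integral_cmult)
  also have "\<dots> = (\<integral>\<^sup>+x. (F x * indicator Q' x) * of_nat (m ^ CARD('k)) \<partial>lborel)"
    using nn_integral_count_half_open_cube(2)[OF n, of w m] by (simp add: Q_def t_def)
  also have "\<dots> = of_nat (m ^ CARD('k)) * (\<integral>\<^sup>+x\<in>Q'. F x \<partial>lborel)"
    by (subst mult.commute, subst nn_integral_cmult) auto
  finally show ?thesis by (simp add: Q_def Q'_def)
qed

section \<open>Integrals over the unit cube and over a single cell\<close>

lemma set_integrable_unit_cube: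
  fixes f :: "real ^ 'k \<Rightarrow> real"
  assumes "f \<in> borel_measurable borel" "\<And>x. 0 \<le> f x" "\<And>x. f x \<le> B"
  shows "set_integrable lborel (cbox 0 1) f"
  unfolding set_integrable_def
  by (rule integrableI_bounded_set_indicator[where B = B])
    (use assms in \<open>auto simp: emeasure_lborel_cbox_eq\<close>)

text \<open>The half-open cube lies between the open and the closed one, which differ by a null set.
  This links the Bochner integral to the nonnegative integral, for which tiling is
  available.\<close>

lemma ennreal_cube_integral:
  fixes f :: "real ^ 'k \<Rightarrow> real"
  assumes [measurable]: "f \<in> borel_measurable borel" and f: "\<And>x. 0 \<le> f x" "\<And>x. f x \<le> B"
  shows "ennreal (cube_integral f) = (\<integral>\<^sup>+x\<in>half_open_cube 0 1. ennreal (f x) \<partial>lborel)"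
proof -
  have "emeasure lborel (cbox 0 1 - box 0 1 :: (real ^ 'k) set)
      = emeasure lborel (cbox 0 1 :: (real ^ 'k) set) - emeasure lborel (box 0 1 :: (real ^ 'k) set)"
    by (intro emeasure_Diff) (auto simp: emeasure_box_vec box_subset_cbox)
  also have "\<dots> = 0"
    by (simp add: emeasure_box_vec)
  finally have "AE x in lborel. x \<notin> cbox 0 1 - (box 0 1 :: (real ^ 'k) set)"
    by (intro AE_not_in) (auto simp: null_sets_def)
  moreover have "box 0 1 \<subseteq> half_open_cube 0 (1 :: real)" "half_open_cube 0 1 \<subseteq> (cbox 0 1 :: (real ^ 'k) set)"
    by (auto simp: half_open_cube_def mem_box_cart less_imp_le)
  then have "x \<in> cbox 0 1 \<longleftrightarrow> x \<in> half_open_cube 0 1" if "x \<notin> cbox 0 1 - box 0 1" for x :: "real ^ 'k"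
    using that by blast
  ultimately have ae: "AE x :: real ^ 'k in lborel. x \<in> cbox 0 1 \<longleftrightarrow> x \<in> half_open_cube 0 1"
    by (rule eventually_mono)
  have "ennreal (cube_integral f) = (\<integral>\<^sup>+x. ennreal (indicator (cbox 0 1) x *\<^sub>R f x) \<partial>lborel)"
    unfolding cube_integral_def set_lebesgue_integral_def
    using set_integrable_unit_cube[OF assms] f
    by (intro nn_integral_eq_integral[symmetric]) (auto simp: set_integrable_def)
  also have "\<dots> = (\<integral>\<^sup>+x\<in>half_open_cube 0 1. ennreal (f x) \<partial>lborel)"
    using ae by (intro nn_integral_cong_AE) (auto elim!: eventually_mono split: split_indicator)
  finally show ?thesis .
qed

lemma cube_integral_nonneg:
  "(\<And>x. 0 \<le> f x) \<Longrightarrow> 0 \<le> cube_integral f"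
  unfolding cube_integral_def set_lebesgue_integral_def by (intro integral_nonneg_AE) auto

text \<open>The unit cube consists of \<open>n ^ CARD('k)\<close> cells of side 1/n, and by
  periodicity a cell with any corner \<open>w\<close> carries the same integral.\<close>

lemma cube_integral_cell:
  fixes f :: "real ^ 'k \<Rightarrow> real"
  assumes n: "0 < n" and f [measurable]: "f \<in> borel_measurable borel"
    and bd: "\<And>x. 0 \<le> f x" "\<And>x. f x \<le> B"
    and per: "\<And>x a. f (x + (1 / real n) *\<^sub>R int_vec a) = f x"
  shows "ennreal (cube_integral f)
    = of_nat (n ^ CARD('k)) * (\<integral>\<^sup>+x\<in>half_open_cube w (1 / real n). ennreal (f x) \<partial>lborel)"
  using nn_integral_periodic_cubes[OF n, of "\<lambda>x. ennreal (f x)" 1 0 n w] n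
  by (simp add: ennreal_cube_integral[OF f bd] per)

lemma cube_integral_shift:
  fixes f :: "real ^ 'k \<Rightarrow> real"
  assumes f [measurable]: "f \<in> borel_measurable borel"
    and bd: "\<And>x. 0 \<le> f x" "\<And>x. f x \<le> B"
    and per: "\<And>x a. f (x + int_vec a) = f x"
  shows "cube_integral (\<lambda>x. f (x + v)) = cube_integral f"
proof -
  have "ennreal (cube_integral (\<lambda>x. f (x + v))) = (\<integral>\<^sup>+x\<in>half_open_cube 0 1. ennreal (f (x + v)) \<partial>lborel)"
    using bd by (intro ennreal_cube_integral) auto
  also have "\<dots> = (\<integral>\<^sup>+x. ennreal (f (x + v)) * indicator (half_open_cube v 1) (x + v) \<partial>lborel)"
    by (intro nn_integral_cong) (auto simp: half_open_cube_def split: split_indicator)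
  also have "\<dots> = (\<integral>\<^sup>+x\<in>half_open_cube v 1. ennreal (f x) \<partial>lborel)"
    by (rule nn_integral_lborel_shift) measurable
  also have "\<dots> = ennreal (cube_integral f)"
    using cube_integral_cell[of 1 f B v] assms by simp
  finally show ?thesis
    using bd by (simp add: cube_integral_nonneg)
qed

section \<open>The central cell\<close>

text \<open>This is the piece of \<open>A_set\<close> around the point y/n, moved to the origin. The
  explicit form, unlike an abstract set from \<open>property_P\<close>, gives access to its size and
  volume.\<close>

definition core :: "'k set_system \<Rightarrow> nat \<Rightarrow> (real ^ 'k) set" where
  "core S n = {z. \<exists>i\<in>idx S (block_index n). \<forall>j.
     \<bar>z $ j\<bar> \<in> interval_of (kind S (block_index n) i j) (width S (block_index n) i j)}"

text \<open>Serves as the link between two estimates: \<open>2 ^ CARD('k)\<close> times it bounds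
  the measure of \<open>core\<close> from above, and a constant multiple of it bounds the integral
  of \<open>f_fun\<close> over one cell from below.\<close>

definition core_volume :: "'k set_system \<Rightarrow> nat \<Rightarrow> real" where
  "core_volume S n = (\<Sum>i\<in>idx S (block_index n). \<Prod>j\<in>UNIV. width S (block_index n) i j)"

text \<open>The representative of \<open>x - y / n\<close> modulo \<open>n\<^sup>-\<^sup>1 \<int>\<^sup>k\<close> in the cell around the origin\<close>

definition to_cell :: "real ^ 'k \<Rightarrow> nat \<Rightarrow> real ^ 'k \<Rightarrow> real ^ 'k" where
  "to_cell y n x = (\<chi> j. x $ j - (real_of_int (round (real n * x $ j - y $ j)) + y $ j) / real n)"

lemma interval_of_scale:
  assumes "0 < n"
  shows "n * t \<in> interval_of T (n * r) \<longleftrightarrow> t \<in> interval_of T r"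
  using assms by (cases T) (auto simp: interval_of_def zero_le_mult_iff)

lemma interval_of_less: "t \<in> interval_of T r \<Longrightarrow> t < r"
  by (cases T) (auto simp: interval_of_def)

lemma admissible_width:
  fixes S :: "'k::finite set_system"
  assumes adm: "admissible \<tau> c c' y S" and n: "1 \<le> n" and i: "i \<in> idx S (block_index n)"
  shows "0 < width S (block_index n) i j"
    and "width S (block_index n) i j \<le> 1 / (2 * real n)"
    and "width S (block_index n) i j \<le> c' * real n powr (\<tau> - 1 - 1 / real CARD('k))"
proof -
  show "0 < width S (block_index n) i j" "width S (block_index n) i j \<le> 1 / (2 * real n)"
    using adm block_index_mem[OF n] i unfolding admissible_def by blast+
  have "width S (block_index n) i j \<le> c' * real n powr - (1 + 1 / real CARD('k) - \<tau>)"
    using adm block_index_mem[OF n] i unfolding admissible_def by blast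
  then show "width S (block_index n) i j \<le> c' * real n powr (\<tau> - 1 - 1 / real CARD('k))"
    by (simp add: algebra_simps)
qed

text \<open>For a point \<open>z\<close> of the cell around the origin, the nearest-integer distance
  defining \<open>A_set\<close> at z + y/n is just \<open>n\<close> times the size of the coordinate
  of \<open>z\<close>. Scaling the intervals by \<open>n\<close> then matches the two
  conditions.\<close>

lemma core_mem_iff:
  assumes adm: "admissible \<tau> c c' y S" and n: "1 \<le> n" and z: "\<And>j. \<bar>z $ j\<bar> \<le> 1 / (2 * real n)"
  shows "z \<in> core S n \<longleftrightarrow> (\<exists>u\<in>A_set y S n. \<exists>a. z + (1 / real n) *\<^sub>R y = u + int_vec a)"
proof -
  have dist: "dist_nearest_int (real n * x - y $ j) = real n * \<bar>z $ j\<bar>"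
    if "z $ j + y $ j / real n = x + real_of_int a" for x j and a :: int
  proof -
    have "real n * x - y $ j - real_of_int (- int n * a) = real n * (x + real_of_int a) - y $ j"
      by (simp add: algebra_simps)
    also have "\<dots> = real n * z $ j"
      using n by (simp flip: that add: distrib_left)
    finally have "\<bar>real n * x - y $ j - real_of_int (- int n * a)\<bar> = real n * \<bar>z $ j\<bar>"
      by (simp only: abs_mult)
    moreover have "real n * \<bar>z $ j\<bar> \<le> 1 / 2"
      using z[of j] n by (simp add: field_simps)
    ultimately show ?thesis
      using dist_nearest_int_eq[of "real n * x - y $ j" "- int n * a"] by linarith
  qed
  show ?thesis
  proof
    assume "z \<in> core S n"
    then obtain i where i: "i \<in> idx S (block_index n)"
      and zi: "\<And>j. \<bar>z $ j\<bar> \<in> interval_of (kind S (block_index n) i j) (width S (block_index n) i j)"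
      by (auto simp: core_def)
    define u where "u = (\<chi> j. frac (z $ j + y $ j / real n))"
    define a where "a = (\<chi> j. \<lfloor>z $ j + y $ j / real n\<rfloor>)"
    have ua: "z $ j + y $ j / real n = u $ j + real_of_int (a $ j)" for j
      by (simp add: u_def a_def frac_def)
    have "u \<in> cbox 0 1"
      by (auto simp: u_def mem_box_cart intro: less_imp_le[OF frac_lt_1])
    then have "u \<in> box_set y S n i"
      using zi n by (auto simp: box_set_def dist[OF ua] interval_of_scale)
    moreover have "z + (1 / real n) *\<^sub>R y = u + int_vec a"
      using ua by (simp add: vec_eq_iff)
    ultimately show "\<exists>u\<in>A_set y S n. \<exists>a. z + (1 / real n) *\<^sub>R y = u + int_vec a"
      using i by (auto simp: A_set_def)
  next
    assume "\<exists>u\<in>A_set y S n. \<exists>a. z + (1 / real n) *\<^sub>R y = u + int_vec a"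
    then obtain u a i where i: "i \<in> idx S (block_index n)" and u: "u \<in> box_set y S n i"
      and ua: "z + (1 / real n) *\<^sub>R y = u + int_vec a"
      by (auto simp: A_set_def)
    have "z $ j + y $ j / real n = u $ j + real_of_int (a $ j)" for j
      using arg_cong[OF ua, of "\<lambda>v. v $ j"] by simp
    then have "\<bar>z $ j\<bar> \<in> interval_of (kind S (block_index n) i j) (width S (block_index n) i j)" for j
      using u n by (simp add: box_set_def dist interval_of_scale)
    then show "z \<in> core S n" using i by (auto simp: core_def)
  qed
qed

text \<open>The first bound keeps the core in the interior of the cell; the second supplies the
  \<open>D\<close> of the lattice count and hence the power of \<open>n\<close> in the error
  term.\<close>

lemma core_bound:
  fixes S :: "'k::finite set_system"
  assumes "admissible \<tau> c c' y S" "1 \<le> n" "z \<in> core S n"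
  shows "\<bar>z $ j\<bar> < 1 / (2 * real n)"
    and "\<bar>z $ j\<bar> < c' * real n powr (\<tau> - 1 - 1 / real CARD('k))"
proof -
  obtain i where i: "i \<in> idx S (block_index n)" and "\<bar>z $ j\<bar> < width S (block_index n) i j"
    using assms(3) interval_of_less unfolding core_def by blast
  then show "\<bar>z $ j\<bar> < 1 / (2 * real n)"
    "\<bar>z $ j\<bar> < c' * real n powr (\<tau> - 1 - 1 / real CARD('k))"
    using admissible_width(2,3)[OF assms(1,2) i, of j] by linarith+
qed

text \<open>The set \<open>Z\<close> of property \<open>P\<close> may exceed the cell, but a point of the cell is coordinatewise at
  most as large as any point of its class modulo \<open>n\<^sup>-\<^sup>1 \<int>\<^sup>k\<close>.\<close>

lemma strongly_star_shaped_core: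
  fixes S :: "'k::finite set_system"
  assumes adm: "admissible \<tau> c c' y S" and n: "1 \<le> n"
  shows "strongly_star_shaped (core S n)"
  unfolding strongly_star_shaped_def
proof (intro ballI allI impI)
  fix x z :: "real ^ 'k"
  assume x: "x \<in> core S n" and zx: "\<forall>j. \<bar>z $ j\<bar> \<le> \<bar>x $ j\<bar>"
  have xn: "\<bar>x $ j\<bar> < 1 / (2 * real n)" for j
    using core_bound(1)[OF adm n x] .
  have zn: "\<bar>z $ j\<bar> \<le> 1 / (2 * real n)" for j
    using zx xn[of j] by (meson less_imp_le order_trans)
  have "property_P n y (A_set y S n)"
    using adm block_index_mem[OF n] unfolding admissible_def by blast
  then obtain Z where Z: "strongly_star_shaped Z"
    and AZ: "{x + int_vec a | x a. x \<in> A_set y S n} = {z + (1 / real n) *\<^sub>R (y + int_vec a) | z a. z \<in> Z}"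
    unfolding property_P_def by blast
  have "x + (1 / real n) *\<^sub>R y \<in> {x + int_vec a | x a. x \<in> A_set y S n}"
    using x core_mem_iff[OF adm n less_imp_le[OF xn]] by auto
  then obtain v b where v: "v \<in> Z" and xv: "x + (1 / real n) *\<^sub>R y = v + (1 / real n) *\<^sub>R (y + int_vec b)"
    unfolding AZ by blast
  have "\<bar>x $ j\<bar> \<le> \<bar>v $ j\<bar>" for j
  proof -
    have "x $ j + y $ j / real n = v $ j + (y $ j + real_of_int (b $ j)) / real n"
      using arg_cong[OF xv, of "\<lambda>v. v $ j"] by simp
    then have e: "real n * x $ j = real n * v $ j + real_of_int (b $ j)"
      using n by (simp add: field_simps)
    have "real n * \<bar>x $ j\<bar> < 1 / 2"
      using xn[of j] n by (simp add: field_simps)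
    then have "\<bar>real n * x $ j\<bar> < 1 / 2" by (simp add: abs_mult)
    \<comment> \<open>For b = 0 the two sizes agree. Otherwise n x and n v differ by at least 1, so
      |n x| < 1/2 forces |n v| > 1/2.\<close>
    moreover have "real_of_int (b $ j) = 0 \<or> 1 \<le> \<bar>real_of_int (b $ j)\<bar>"
      by (cases "b $ j = 0") (simp, linarith)
    ultimately have "\<bar>real n * x $ j\<bar> \<le> \<bar>real n * v $ j\<bar>"
      using e by linarith
    then show ?thesis using n by (simp add: abs_mult)
  qed
  then have "z \<in> Z"
    using Z v zx unfolding strongly_star_shaped_def by (meson order_trans)
  then have "z + (1 / real n) *\<^sub>R y \<in> {z + (1 / real n) *\<^sub>R (y + int_vec a) | z a. z \<in> Z}"
    by (intro CollectI exI[of _ z] exI[of _ 0]) (simp add: vec_eq_iff)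
  then show "z \<in> core S n"
    unfolding AZ[symmetric] using core_mem_iff[OF adm n zn] by auto
qed

text \<open>Each piece is enclosed in the full closed box with half-sides \<open>width\<close>,
  whatever its interval types; the two signs in each coordinate produce the power of 2.\<close>

lemma core_subset_measurable:
  fixes S :: "'k::finite set_system"
  assumes adm: "admissible \<tau> c c' y S" and n: "1 \<le> n"
  obtains Y where "core S n \<subseteq> Y" "Y \<in> sets lborel"
    "emeasure lborel Y \<le> ennreal (2 ^ CARD('k) * core_volume S n)"
proof -
  define M where "M = block_index n"
  define d where "d i = (\<chi> j. width S M i j)" for i
  define Y where "Y = (\<Union>i\<in>idx S M. cbox (- d i) (d i))"
  have fin: "finite (idx S M)"
    using adm block_index_mem[OF n] unfolding admissible_def M_def by blast
  have "core S n \<subseteq> Y"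
  proof
    fix z assume "z \<in> core S n"
    then obtain i where i: "i \<in> idx S M" and "\<And>j. \<bar>z $ j\<bar> < width S M i j"
      using interval_of_less unfolding core_def M_def by blast
    then have "- width S M i j \<le> z $ j \<and> z $ j \<le> width S M i j" for j
      by (smt (verit))
    then show "z \<in> Y" using i by (auto simp: Y_def d_def mem_box_cart)
  qed
  moreover have "Y \<in> sets lborel"
    unfolding Y_def using fin by (intro sets.finite_UN) auto
  moreover have "emeasure lborel Y \<le> ennreal (2 ^ CARD('k) * core_volume S n)"
  proof -
    have "emeasure lborel Y \<le> (\<Sum>i\<in>idx S M. emeasure lborel (cbox (- d i) (d i)))"
      unfolding Y_def by (rule emeasure_subadditive_finite[OF fin]) auto
    also have "\<dots> = (\<Sum>i\<in>idx S M. ennreal (2 ^ CARD('k) * (\<Prod>j\<in>UNIV. width S M i j)))"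
    proof (rule sum.cong)
      fix i assume i: "i \<in> idx S M"
      have "0 < width S M i j" for j
        using admissible_width(1)[OF adm n] i unfolding M_def by blast
      then have "(- d i) $ j \<le> d i $ j" for j
        by (simp add: d_def less_imp_le)
      then have "emeasure lborel (cbox (- d i) (d i)) = ennreal (\<Prod>j\<in>UNIV. 2 * width S M i j)"
        by (subst emeasure_box_vec(2)) (auto simp: d_def)
      then show "emeasure lborel (cbox (- d i) (d i)) = ennreal (2 ^ CARD('k) * (\<Prod>j\<in>UNIV. width S M i j))"
        by (simp add: prod.distrib)
    qed simp
    also have "\<dots> = ennreal (\<Sum>i\<in>idx S M. 2 ^ CARD('k) * (\<Prod>j\<in>UNIV. width S M i j))"
      using admissible_width(1)[OF adm n] unfolding M_def
      by (intro sum_ennreal mult_nonneg_nonneg prod_nonneg) (auto intro: less_imp_le)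
    also have "(\<Sum>i\<in>idx S M. 2 ^ CARD('k) * (\<Prod>j\<in>UNIV. width S M i j)) = 2 ^ CARD('k) * core_volume S n"
      by (simp add: core_volume_def M_def sum_distrib_left)
    finally show ?thesis .
  qed
  ultimately show thesis by (rule that)
qed

section \<open>Bump functions, and the shape and mass of the associated functions\<close>

lemma continuous_bump: "bump_function U \<omega> \<Longrightarrow> isCont \<omega> t"
  by (metis bump_function_def smooth_def funpow_0 differentiable_imp_continuous_within)

lemma bump_measurable [measurable_dest]: "bump_function U \<omega> \<Longrightarrow> \<omega> \<in> borel_measurable borel"
  by (intro borel_measurable_continuous_onI continuous_at_imp_continuous_on) (auto intro: continuous_bump)

text \<open>Continuity at a point where the function is positive gives half of that value on a short
  interval to its right.\<close>

lemma bump_ge_on_interval: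
  assumes "bump_function U \<omega>"
  obtains \<delta> p l where "0 < \<delta>" "0 < l" "\<And>t. p \<le> t \<Longrightarrow> t \<le> p + l \<Longrightarrow> \<delta> \<le> \<omega> t"
proof -
  obtain t0 where t0: "0 < \<omega> t0"
    using assms unfolding bump_function_def by (metis less_eq_real_def)
  then obtain e where e: "0 < e" "\<And>t. dist t t0 < e \<Longrightarrow> dist (\<omega> t) (\<omega> t0) < \<omega> t0 / 2"
    using continuous_bump[OF assms, of t0] unfolding continuous_at_eps_delta dist_real_def
    by (metis half_gt_zero)
  have "\<omega> t0 / 2 \<le> \<omega> t" if "t0 \<le> t" "t \<le> t0 + e / 2" for t
  proof -
    have "dist t t0 < e" using that e(1) by (auto simp: dist_real_def)
    then have "\<bar>\<omega> t - \<omega> t0\<bar> < \<omega> t0 / 2" using e(2)[of t] by (simp add: dist_real_def)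
    then show ?thesis by linarith
  qed
  with t0 e(1) show thesis by (intro that[of "\<omega> t0 / 2" "e / 2" t0]) auto
qed

context
  fixes \<omega>1 \<omega>2 :: "real \<Rightarrow> real" and \<tau> c c' :: real and y :: "real ^ 'k"
    and S :: "'k set_system" and n :: nat
  assumes bump1: "bump_function {t. \<bar>t\<bar> < 1} \<omega>1"
    and bump2: "bump_function {t. 1 / 2 \<le> \<bar>t\<bar> \<and> \<bar>t\<bar> < 1} \<omega>2"
    and adm: "admissible \<tau> c c' y S" and n: "1 \<le> n"
begin

private abbreviation "M \<equiv> block_index n"

private lemma bump_of_bounds: "0 \<le> bump_of \<omega>1 \<omega>2 T t" "bump_of \<omega>1 \<omega>2 T t \<le> 1"
  using bump1 bump2 by (cases T; auto simp: bump_of_def bump_function_def)+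

private lemma bump_of_nonzero: "bump_of \<omega>1 \<omega>2 T t \<noteq> 0 \<Longrightarrow> \<bar>t\<bar> \<in> interval_of T 1"
  using bump1 bump2 by (cases T) (auto simp: bump_of_def bump_function_def interval_of_def)

private lemma bump_of_measurable [measurable]: "bump_of \<omega>1 \<omega>2 T \<in> borel_measurable borel"
  using bump_measurable[OF bump1] bump_measurable[OF bump2] by (cases T) (auto simp: bump_of_def)

private lemma width_pos: "i \<in> idx S M \<Longrightarrow> 0 < width S M i j"
  using admissible_width(1)[OF adm n] .

private lemma bump_of_scaled_nonzero:
  assumes "bump_of \<omega>1 \<omega>2 (kind S M i j) (t / width S M i j) \<noteq> 0" "i \<in> idx S M"
  shows "\<bar>t\<bar> \<in> interval_of (kind S M i j) (width S M i j)"
  using bump_of_nonzero[OF assms(1)] width_pos[OF assms(2), of j]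
    interval_of_scale[of "width S M i j" "\<bar>t\<bar> / width S M i j" "kind S M i j" 1]
  by simp

text \<open>Since \<open>width\<close> is at most 1/(2n), only the lattice point nearest to
  \<open>x\<close> can contribute, and the infinite sum collapses to one term.\<close>

lemma f_fun_eq:
  "f_fun \<omega>1 \<omega>2 y S n x = (\<Sum>i\<in>idx S M. \<Prod>j\<in>UNIV.
     bump_of \<omega>1 \<omega>2 (kind S M i j) (to_cell y n x $ j / width S M i j))"
  unfolding f_fun_def
proof (rule sum.cong)
  fix i assume i: "i \<in> idx S M"
  define T where "T a = (\<Prod>j\<in>UNIV. bump_of \<omega>1 \<omega>2 (kind S M i j)
      ((x $ j - (real_of_int (a $ j) + y $ j) / real n) / width S M i j))" for a :: "int ^ 'k"
  define a0 :: "int ^ 'k" where "a0 = (\<chi> j. round (real n * x $ j - y $ j))"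
  have "T a = 0" if "a \<noteq> a0" for a
  proof (rule ccontr)
    assume "T a \<noteq> 0"
    then have nz: "bump_of \<omega>1 \<omega>2 (kind S M i j)
      ((x $ j - (real_of_int (a $ j) + y $ j) / real n) / width S M i j) \<noteq> 0" for j
      by (auto simp: T_def)
    have "a $ j = a0 $ j" for j
    proof -
      have "\<bar>x $ j - (real_of_int (a $ j) + y $ j) / real n\<bar> < 1 / (2 * real n)"
        using interval_of_less[OF bump_of_scaled_nonzero[OF nz i, of j]] admissible_width(2)[OF adm n i, of j]
        by linarith
      then have "real n * \<bar>x $ j - (real_of_int (a $ j) + y $ j) / real n\<bar> < 1 / 2"
        using n by (simp add: field_simps)
      also have "real n * \<bar>x $ j - (real_of_int (a $ j) + y $ j) / real n\<bar>
          = \<bar>real n * (x $ j - (real_of_int (a $ j) + y $ j) / real n)\<bar>"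
        by (simp add: abs_mult)
      also have "real n * (x $ j - (real_of_int (a $ j) + y $ j) / real n)
          = real n * x $ j - y $ j - real_of_int (a $ j)"
        using n by (simp add: field_simps)
      finally show ?thesis
        unfolding a0_def vec_lambda_beta by (intro round_unique'[symmetric])
    qed
    with that show False by (simp add: vec_eq_iff)
  qed
  then have "(\<Sum>\<^sub>\<infinity>a. T a) = (\<Sum>\<^sub>\<infinity>a\<in>{a0}. T a)"
    by (intro infsum_cong_neutral) auto
  also have "\<dots> = T a0" by simp
  finally show "(\<Sum>\<^sub>\<infinity>a. \<Prod>j\<in>UNIV. bump_of \<omega>1 \<omega>2 (kind S M i j)
      ((x $ j - (real_of_int (a $ j) + y $ j) / real n) / width S M i j))
    = (\<Prod>j\<in>UNIV. bump_of \<omega>1 \<omega>2 (kind S M i j) (to_cell y n x $ j / width S M i j))"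
    by (simp add: T_def a0_def to_cell_def)
qed simp

lemma f_fun_measurable: "f_fun \<omega>1 \<omega>2 y S n \<in> borel_measurable borel"
proof -
  have [measurable]: "(\<lambda>x. to_cell y n x $ j) \<in> borel_measurable borel" for j
    unfolding to_cell_def vec_lambda_beta round_def by measurable
  show ?thesis
    unfolding f_fun_eq[abs_def] by measurable
qed

lemma f_fun_periodic: "f_fun \<omega>1 \<omega>2 y S n (x + (1 / real n) *\<^sub>R int_vec a) = f_fun \<omega>1 \<omega>2 y S n x"
proof -
  have "to_cell y n (x + (1 / real n) *\<^sub>R int_vec a) $ j = to_cell y n x $ j" for j
  proof -
    \<comment> \<open>The summand 1/2 is carried along because \<open>round\<close> is the floor
      after adding 1/2.\<close>
    have "real n * (x $ j + real_of_int (a $ j) / real n) - y $ j + 1 / 2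
        = real n * x $ j - y $ j + 1 / 2 + real_of_int (a $ j)"
      using n by (simp add: field_simps)
    then have "round (real n * (x $ j + real_of_int (a $ j) / real n) - y $ j)
        = round (real n * x $ j - y $ j) + a $ j"
      unfolding round_def by (simp only: floor_add_int)
    then show ?thesis by (simp add: to_cell_def add_divide_distrib)
  qed
  then show ?thesis by (simp add: f_fun_eq)
qed

lemma f_fun_periodic_int: "f_fun \<omega>1 \<omega>2 y S n (x + int_vec a) = f_fun \<omega>1 \<omega>2 y S n x"
proof -
  have "int_vec a = (1 / real n) *\<^sub>R int_vec (\<chi> j. int n * a $ j)"
    using n by (simp add: vec_eq_iff)
  then show ?thesis by (simp only: f_fun_periodic)
qed

lemma f_fun_nonzero_core:
  assumes "f_fun \<omega>1 \<omega>2 y S n x \<noteq> 0"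
  shows "\<exists>b. x - (1 / real n) *\<^sub>R y - (1 / real n) *\<^sub>R int_vec b \<in> core S n"
proof -
  from assms obtain i where i: "i \<in> idx S M"
    and "(\<Prod>j\<in>UNIV. bump_of \<omega>1 \<omega>2 (kind S M i j) (to_cell y n x $ j / width S M i j)) \<noteq> 0"
    unfolding f_fun_eq by (meson sum.neutral)
  then have "\<bar>to_cell y n x $ j\<bar> \<in> interval_of (kind S M i j) (width S M i j)" for j
    using bump_of_scaled_nonzero[OF _ i] by auto
  then have "to_cell y n x \<in> core S n"
    using i by (auto simp: core_def)
  moreover have "to_cell y n x = x - (1 / real n) *\<^sub>R y
      - (1 / real n) *\<^sub>R int_vec (\<chi> j. round (real n * x $ j - y $ j))"
    by (simp add: vec_eq_iff to_cell_def add_divide_distrib)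
  ultimately show ?thesis by metis
qed

lemma core_volume_nonneg: "0 \<le> core_volume S n"
  unfolding core_volume_def by (intro sum_nonneg prod_nonneg) (auto intro: less_imp_le width_pos)

text \<open>For each index \<open>i\<close> there is a box with sides \<open>l\<close> times the
  widths on which all bump factors are at least \<delta>, so the \<open>i\<close>-th summand is at
  least \<open>\<delta> ^ CARD('k)\<close> there. Integrating over the cell centred at y/n and
  multiplying by the number of cells gives the bound.\<close>

lemma core_volume_le_cube_integral:
  assumes \<delta>: "0 < \<delta>" and l: "0 < l"
    and p: "\<And>T t. p T \<le> t \<Longrightarrow> t \<le> p T + l \<Longrightarrow> \<delta> \<le> bump_of \<omega>1 \<omega>2 T t"
  shows "real n ^ CARD('k) * ((\<delta> * l) ^ CARD('k) * core_volume S n) \<le> cube_integral (f_fun \<omega>1 \<omega>2 y S n)"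
proof -
  let ?f = "f_fun \<omega>1 \<omega>2 y S n"
  let ?d = "width S M"
  let ?p = "\<lambda>i j. p (kind S M i j)"
  define w where "w = (\<chi> j. y $ j / real n - 1 / (2 * real n))"
  define lo where "lo i = (\<chi> j. y $ j / real n + ?p i j * ?d i j)" for i
  define B where "B i = cbox (lo i) (\<chi> j. lo i $ j + l * ?d i j)" for i
  \<comment> \<open>The bump is nonzero at both ends of the interval, so the whole interval lies in
    (-1, 1); this keeps every box \<open>B i\<close> inside the cell.\<close>
  have p1: "\<bar>p T\<bar> < 1" "\<bar>p T + l\<bar> < 1" for T
  proof -
    have "bump_of \<omega>1 \<omega>2 T (p T) \<noteq> 0" "bump_of \<omega>1 \<omega>2 T (p T + l) \<noteq> 0"
      using p[of T "p T"] p[of T "p T + l"] l \<delta> by linarith+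
    then show "\<bar>p T\<bar> < 1" "\<bar>p T + l\<bar> < 1"
      using interval_of_less[OF bump_of_nonzero] by blast+
  qed
  have B_cell: "\<bar>x $ j - y $ j / real n\<bar> < 1 / (2 * real n)"
    and B_bump: "\<delta> \<le> bump_of \<omega>1 \<omega>2 (kind S M i j) ((x $ j - y $ j / real n) / ?d i j)"
    if x: "x \<in> B i" and i: "i \<in> idx S M" for x i j
  proof -
    define u where "u = (x $ j - y $ j / real n) / ?d i j"
    note d = width_pos[OF i, of j]
    have xu: "x $ j - y $ j / real n = u * ?d i j" using d by (simp add: u_def)
    have "lo i $ j \<le> x $ j \<and> x $ j \<le> lo i $ j + l * ?d i j"
      using x by (auto simp: B_def mem_box_cart)
    then have "?p i j * ?d i j \<le> u * ?d i j \<and> u * ?d i j \<le> (?p i j + l) * ?d i j"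
      using xu by (simp add: lo_def algebra_simps)
    then have u: "?p i j \<le> u" "u \<le> ?p i j + l" using d by auto
    then show "\<delta> \<le> bump_of \<omega>1 \<omega>2 (kind S M i j) ((x $ j - y $ j / real n) / ?d i j)"
      using p by (simp add: u_def)
    have "\<bar>u\<bar> < 1" using u p1[of "kind S M i j"] by linarith
    then have "\<bar>u\<bar> * ?d i j < 1 * ?d i j" using d by (intro mult_strict_right_mono)
    also have "\<dots> \<le> 1 / (2 * real n)" using admissible_width(2)[OF adm n i, of j] by simp
    finally show "\<bar>x $ j - y $ j / real n\<bar> < 1 / (2 * real n)"
      using d by (simp add: xu abs_mult)
  qed
  have to_cell: "to_cell y n x $ j = x $ j - y $ j / real n"
    if x: "\<bar>x $ j - y $ j / real n\<bar> < 1 / (2 * real n)" for x j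
  proof -
    have "real n * x $ j - y $ j = real n * (x $ j - y $ j / real n)"
      using n by (simp add: right_diff_distrib)
    then have "\<bar>real n * x $ j - y $ j\<bar> = real n * \<bar>x $ j - y $ j / real n\<bar>"
      by (simp add: abs_mult)
    also have "\<dots> < 1 / 2" using x n by (simp add: field_simps)
    finally have "round (real n * x $ j - y $ j) = 0"
      by (intro round_unique') simp
    then show ?thesis by (simp add: to_cell_def)
  qed
  have term_nonneg: "0 \<le> (\<Prod>j\<in>UNIV. bump_of \<omega>1 \<omega>2 (kind S M i j) (t j))" for i t
    by (intro prod_nonneg) (auto simp: bump_of_bounds)
  have le: "(\<Sum>i\<in>idx S M. \<delta> ^ CARD('k) * indicator (B i) x) \<le> ?f x * indicator (half_open_cube w (1 / real n)) x" for x
  proof (cases "\<exists>i\<in>idx S M. x \<in> B i")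
    case False
    then show ?thesis using f_fun_bounds(1)[OF bump1 bump2 adm n] by simp
  next
    case True
    then have cell: "\<bar>x $ j - y $ j / real n\<bar> < 1 / (2 * real n)" for j
      using B_cell by blast
    have "w $ j \<le> x $ j \<and> x $ j < w $ j + 1 / real n" for j
    proof -
      have "1 / real n = 1 / (2 * real n) + 1 / (2 * real n)" by simp
      then show ?thesis using cell[of j] unfolding w_def by (simp add: abs_less_iff)
    qed
    then have "x \<in> half_open_cube w (1 / real n)"
      by (simp add: half_open_cube_def)
    moreover have "(\<Sum>i\<in>idx S M. \<delta> ^ CARD('k) * indicator (B i) x) \<le> ?f x"
      unfolding f_fun_eq
    proof (rule sum_mono)
      fix i assume i: "i \<in> idx S M"
      show "\<delta> ^ CARD('k) * indicator (B i) x
        \<le> (\<Prod>j\<in>UNIV. bump_of \<omega>1 \<omega>2 (kind S M i j) (to_cell y n x $ j / ?d i j))"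
      proof (cases "x \<in> B i")
        case True
        have "(\<Prod>j\<in>(UNIV :: 'k set). \<delta>)
          \<le> (\<Prod>j\<in>UNIV. bump_of \<omega>1 \<omega>2 (kind S M i j) (to_cell y n x $ j / ?d i j))"
          using B_bump[OF True i] \<delta> by (intro prod_mono) (simp add: to_cell[OF cell])
        then show ?thesis using True by simp
      qed (simp add: term_nonneg)
    qed
    ultimately show ?thesis by simp
  qed
  have "ennreal ((\<delta> * l) ^ CARD('k) * core_volume S n)
      = ennreal (\<Sum>i\<in>idx S M. \<delta> ^ CARD('k) * (\<Prod>j\<in>UNIV. l * ?d i j))"
    by (simp add: core_volume_def sum_distrib_left prod.distrib power_mult_distrib mult.assoc)
  also have "\<dots> = (\<Sum>i\<in>idx S M. ennreal (\<delta> ^ CARD('k)) * emeasure lborel (B i))"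
  proof -
    have "emeasure lborel (B i) = ennreal (\<Prod>j\<in>UNIV. l * ?d i j)" if "i \<in> idx S M" for i
      unfolding B_def using width_pos[OF that] l
      by (subst emeasure_box_vec(2)) (auto simp: less_imp_le)
    then show ?thesis
      using width_pos l \<delta>
      by (subst sum_ennreal[symmetric]) (auto intro!: sum.cong mult_nonneg_nonneg prod_nonneg simp: less_imp_le ennreal_mult')
  qed
  also have "\<dots> = (\<integral>\<^sup>+x. (\<Sum>i\<in>idx S M. ennreal (\<delta> ^ CARD('k)) * indicator (B i) x) \<partial>lborel)"
    by (subst nn_integral_sum) (auto simp: B_def nn_integral_cmult_indicator)
  also have "\<dots> = (\<integral>\<^sup>+x. ennreal (\<Sum>i\<in>idx S M. \<delta> ^ CARD('k) * indicator (B i) x) \<partial>lborel)"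
    using \<delta> by (intro nn_integral_cong)
      (auto simp: ennreal_mult'' ennreal_indicator simp flip: sum_ennreal)
  also have "\<dots> \<le> (\<integral>\<^sup>+x\<in>half_open_cube w (1 / real n). ennreal (?f x) \<partial>lborel)"
  proof (rule nn_integral_mono)
    fix x
    have "ennreal (\<Sum>i\<in>idx S M. \<delta> ^ CARD('k) * indicator (B i) x)
        \<le> ennreal (?f x * indicator (half_open_cube w (1 / real n)) x)"
      by (rule ennreal_leI[OF le])
    then show "ennreal (\<Sum>i\<in>idx S M. \<delta> ^ CARD('k) * indicator (B i) x)
        \<le> ennreal (?f x) * indicator (half_open_cube w (1 / real n)) x"
      by (cases "x \<in> half_open_cube w (1 / real n)") simp_all
  qed
  finally have cell: "ennreal ((\<delta> * l) ^ CARD('k) * core_volume S n)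
      \<le> (\<integral>\<^sup>+x\<in>half_open_cube w (1 / real n). ennreal (?f x) \<partial>lborel)" .
  have "ennreal (real n ^ CARD('k) * ((\<delta> * l) ^ CARD('k) * core_volume S n))
      = of_nat (n ^ CARD('k)) * ennreal ((\<delta> * l) ^ CARD('k) * core_volume S n)"
    by (simp add: ennreal_mult' ennreal_of_nat_eq_real_of_nat flip: of_nat_power)
  also have "\<dots> \<le> of_nat (n ^ CARD('k)) * (\<integral>\<^sup>+x\<in>half_open_cube w (1 / real n). ennreal (?f x) \<partial>lborel)"
    using cell by (rule mult_left_mono) simp
  also have "\<dots> = ennreal (cube_integral ?f)"
    using n f_fun_bounds[OF bump1 bump2 adm n]
    by (intro cube_integral_cell[symmetric] f_fun_measurable f_fun_periodic) auto
  finally show ?thesis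
    using f_fun_bounds(1)[OF bump1 bump2 adm n] by (simp add: cube_integral_nonneg)
qed

end

section \<open>Correlations\<close>

text \<open>Each value is at most 1, so the sum is at most the number of shifts that meet the
  support. The coprimality argument bounds that number by the gcd to the power k times a lattice
  count in the core.\<close>

lemma sum_integer_shifts_le:
  fixes S :: "'k::finite set_system"
  assumes bumps: "bump_function {t. \<bar>t\<bar> < 1} \<omega>1" "bump_function {t. 1 / 2 \<le> \<bar>t\<bar> \<and> \<bar>t\<bar> < 1} \<omega>2"
    and adm: "admissible \<tau> c c' y S" and c': "0 < c'" and n: "1 \<le> n" "1 \<le> n'"
  shows "(\<Sum>r\<in>{r :: int ^ 'k. \<forall>j. r $ j \<in> {0..<int n}}. f_fun \<omega>1 \<omega>2 y S n' (x + (1 / real n) *\<^sub>R int_vec r))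
    \<le> (2 * real n * real n') ^ CARD('k) * core_volume S n' + real (gcd n n') ^ CARD('k) *
       (2 * real CARD('k) * (2 * (c' * real n' powr (\<tau> - 1 - 1 / real CARD('k)))
          / (real (gcd n n') / (real n * real n')) + 1) ^ (CARD('k) - 1))"
proof -
  let ?f = "f_fun \<omega>1 \<omega>2 y S n'"
  define R where "R = {r :: int ^ 'k. \<forall>j. r $ j \<in> {0..<int n}}"
  define h where "h = real (gcd n n') / (real n * real n')"
  define D where "D = c' * real n' powr (\<tau> - 1 - 1 / real CARD('k))"
  define w where "w = x - (1 / real n') *\<^sub>R y"
  define P where "P = {s. w + h *\<^sub>R int_vec s \<in> core S n'}"
  define R' where "R' = {r :: int ^ 'k. (\<forall>j. r $ j \<in> {0..<int n}) \<and>
           (\<exists>b. w + (1 / real n) *\<^sub>R int_vec r - (1 / real n') *\<^sub>R int_vec b \<in> core S n')}"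
  have h: "0 < h" and D: "0 \<le> D"
    using n c' by (auto simp: h_def D_def)
  have finR: "finite R"
    unfolding R_def by (rule card_vec_box(1)) simp
  have R': "R' \<subseteq> R" "finite R'"
    using finR by (auto simp: R'_def R_def elim: finite_subset[rotated])
  obtain Y where Y: "core S n' \<subseteq> Y" "Y \<in> sets lborel"
      "emeasure lborel Y \<le> ennreal (2 ^ CARD('k) * core_volume S n')"
    using core_subset_measurable[OF adm n(2)] .
  have v: "0 \<le> 2 ^ CARD('k) * core_volume S n'"
    using core_volume_nonneg[OF bumps adm n(2)] by simp
  have bound: "\<bar>z $ j\<bar> < D" if "z \<in> core S n'" for z j
    using core_bound(2)[OF adm n(2) that] by (simp add: D_def)
  note P = card_lattice_star_shaped[OF h D strongly_star_shaped_core[OF adm n(2)] bound Y v, of w, folded P_def]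
  have "?f (x + (1 / real n) *\<^sub>R int_vec r) \<le> indicator R' r" if r: "r \<in> R" for r
  proof (cases "?f (x + (1 / real n) *\<^sub>R int_vec r) = 0")
    case False
    then obtain b where "x + (1 / real n) *\<^sub>R int_vec r - (1 / real n') *\<^sub>R y - (1 / real n') *\<^sub>R int_vec b \<in> core S n'"
      using f_fun_nonzero_core[OF bumps adm n(2)] by blast
    moreover have "x + (1 / real n) *\<^sub>R int_vec r - (1 / real n') *\<^sub>R y = w + (1 / real n) *\<^sub>R int_vec r"
      by (simp add: w_def)
    ultimately have "r \<in> R'" using r by (auto simp: R'_def R_def)
    then show ?thesis using f_fun_bounds(2)[OF bumps adm n(2)] by simp
  qed simp
  then have "(\<Sum>r\<in>R. ?f (x + (1 / real n) *\<^sub>R int_vec r)) \<le> (\<Sum>r\<in>R. indicator R' r)"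
    by (rule sum_mono)
  also have "\<dots> = real (card R')"
    using R' finR by (simp add: indicator_def sum.If_cases Int_absorb1)
  also have "\<dots> \<le> real (card P * gcd n n' ^ CARD('k))"
    using card_rational_shifts[of n n' w "core S n'"] n P(1)
    unfolding R'_def P_def h_def by (intro of_nat_mono) simp
  also have "\<dots> = real (gcd n n') ^ CARD('k) * real (card P)"
    by simp
  also have "\<dots> \<le> real (gcd n n') ^ CARD('k) *
      (2 ^ CARD('k) * core_volume S n' / h ^ CARD('k) + 2 * real CARD('k) * (2 * D / h + 1) ^ (CARD('k) - 1))"
    using P(2) by (intro mult_left_mono) auto
  also have "\<dots> = (2 * real n * real n') ^ CARD('k) * core_volume S n' + real (gcd n n') ^ CARD('k) *
       (2 * real CARD('k) * (2 * D / h + 1) ^ (CARD('k) - 1))"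
  \<comment> \<open>In the volume term the power of the gcd cancels against that in
    \<open>h ^ CARD('k)\<close>, leaving a power of n n' alone.\<close>
  proof -
    have "real (gcd n n') ^ CARD('k) / h ^ CARD('k) = (real n * real n') ^ CARD('k)"
      using n by (simp add: h_def flip: power_divide)
    moreover have "real (gcd n n') ^ CARD('k) * (2 ^ CARD('k) * core_volume S n' / h ^ CARD('k))
        = 2 ^ CARD('k) * (real (gcd n n') ^ CARD('k) / h ^ CARD('k)) * core_volume S n'"
      by simp
    ultimately have "real (gcd n n') ^ CARD('k) * (2 ^ CARD('k) * core_volume S n' / h ^ CARD('k))
        = 2 ^ CARD('k) * (real n * real n') ^ CARD('k) * core_volume S n'"
      by simp
    then show ?thesis by (simp add: distrib_left power_mult_distrib)
  qed
  finally show ?thesis by (simp add: R_def h_def D_def)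
qed

text \<open>Shifting the second factor by r/n does not change the correlation, so
  \<open>n ^ CARD('k)\<close> copies of it add up to the integral of the first factor times the sum
  bounded by \<open>M\<close>.\<close>

lemma cube_integral_correlation_le:
  fixes S :: "'k::finite set_system"
  assumes bumps: "bump_function {t. \<bar>t\<bar> < 1} \<omega>1" "bump_function {t. 1 / 2 \<le> \<bar>t\<bar> \<and> \<bar>t\<bar> < 1} \<omega>2"
    and adm: "admissible \<tau> c c' y S" and n: "1 \<le> n" "1 \<le> n'"
    and M: "\<And>x. (\<Sum>r\<in>{r :: int ^ 'k. \<forall>j. r $ j \<in> {0..<int n}}.
              f_fun \<omega>1 \<omega>2 y S n' (x + (1 / real n) *\<^sub>R int_vec r)) \<le> M"
  shows "real n ^ CARD('k) * cube_integral (\<lambda>x. f_fun \<omega>1 \<omega>2 y S n x * f_fun \<omega>1 \<omega>2 y S n' (x + \<gamma>))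
    \<le> cube_integral (f_fun \<omega>1 \<omega>2 y S n) * M"
proof -
  let ?f = "f_fun \<omega>1 \<omega>2 y S n"
  let ?f' = "f_fun \<omega>1 \<omega>2 y S n'"
  define R where "R = {r :: int ^ 'k. \<forall>j. r $ j \<in> {0..<int n}}"
  define t where "t r = (1 / real n) *\<^sub>R int_vec r" for r :: "int ^ 'k"
  note [measurable] = f_fun_measurable[OF bumps adm n(1)] f_fun_measurable[OF bumps adm n(2)]
  note b = f_fun_bounds[OF bumps adm n(1)] and b' = f_fun_bounds[OF bumps adm n(2)]
  have cardR: "card R = n ^ CARD('k)"
    unfolding R_def using card_vec_box(2)[of "\<lambda>_. {0..<int n}"] by simp
  have prod: "0 \<le> ?f x * ?f' z" "?f x * ?f' z \<le> 1" for x z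
    using b b' by (auto intro: mult_le_one)
  have meas [measurable]: "(\<lambda>x. ?f x * ?f' (x + v)) \<in> borel_measurable borel" for v
    by measurable
  \<comment> \<open>The whole integrand is translated by \<open>t r\<close>; the first factor
    absorbs this by its period 1/n, and the shift survives in the second factor only.\<close>
  have shift: "cube_integral (\<lambda>x. ?f x * ?f' (x + \<gamma> + t r)) = cube_integral (\<lambda>x. ?f x * ?f' (x + \<gamma>))" for r
  proof -
    have "?f (x + int_vec a) * ?f' (x + int_vec a + \<gamma>) = ?f x * ?f' (x + \<gamma>)" for x a
      using f_fun_periodic_int[OF bumps adm n(1), of x a] f_fun_periodic_int[OF bumps adm n(2), of "x + \<gamma>" a]
      by (simp add: ac_simps)
    then have "cube_integral (\<lambda>x. ?f (x + t r) * ?f' (x + t r + \<gamma>)) = cube_integral (\<lambda>x. ?f x * ?f' (x + \<gamma>))"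
      using cube_integral_shift[OF meas[of \<gamma>] prod] by blast
    then show ?thesis
      by (simp add: t_def f_fun_periodic[OF bumps adm n(1)] ac_simps)
  qed
  have int: "set_integrable lborel (cbox 0 1) (\<lambda>x. ?f x * ?f' (x + \<gamma> + t r))" for r
    using prod meas[of "\<gamma> + t r"] by (intro set_integrable_unit_cube[where B = 1]) (auto simp: add.assoc)
  have "real n ^ CARD('k) * cube_integral (\<lambda>x. ?f x * ?f' (x + \<gamma>))
      = (\<Sum>r\<in>R. cube_integral (\<lambda>x. ?f x * ?f' (x + \<gamma> + t r)))"
    by (simp add: shift cardR)
  also have "\<dots> = (LINT x:cbox 0 1|lborel. (\<Sum>r\<in>R. ?f x * ?f' (x + \<gamma> + t r)))"
    unfolding cube_integral_def
    using int unfolding set_lebesgue_integral_def set_integrable_def scaleR_sum_right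
    by (intro Bochner_Integration.integral_sum[symmetric])
  also have "\<dots> \<le> (LINT x:cbox 0 1|lborel. ?f x * M)"
  proof (rule set_integral_mono)
    show "set_integrable lborel (cbox 0 1) (\<lambda>x. \<Sum>r\<in>R. ?f x * ?f' (x + \<gamma> + t r))"
      using int unfolding set_integrable_def scaleR_sum_right by (intro Bochner_Integration.integrable_sum)
    show "set_integrable lborel (cbox 0 1) (\<lambda>x. ?f x * M)"
      using set_integrable_unit_cube[OF f_fun_measurable[OF bumps adm n(1)] b] by (intro set_integrable_mult_left) auto
    show "(\<Sum>r\<in>R. ?f x * ?f' (x + \<gamma> + t r)) \<le> ?f x * M" for x
      using M[of "x + \<gamma>"] b(1) by (simp add: R_def t_def mult_left_mono flip: sum_distrib_left)
  qed
  also have "\<dots> = cube_integral ?f * M"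
    by (simp add: cube_integral_def)
  finally show ?thesis .
qed

lemma cube_integral_correlation_one_sided:
  fixes S :: "'k::finite set_system"
  assumes bumps: "bump_function {t. \<bar>t\<bar> < 1} \<omega>1" "bump_function {t. 1 / 2 \<le> \<bar>t\<bar> \<and> \<bar>t\<bar> < 1} \<omega>2"
    and \<delta>: "0 < \<delta>" and l: "0 < l"
    and p: "\<And>T t. p T \<le> t \<Longrightarrow> t \<le> p T + l \<Longrightarrow> \<delta> \<le> bump_of \<omega>1 \<omega>2 T t"
    and adm: "admissible \<tau> c c' y S" and c': "0 < c'" and n: "1 \<le> n" "1 \<le> n'"
  shows "cube_integral (\<lambda>x. f_fun \<omega>1 \<omega>2 y S n x * f_fun \<omega>1 \<omega>2 y S n' (x + \<gamma>))
    \<le> (2 / (\<delta> * l)) ^ CARD('k) * cube_integral (f_fun \<omega>1 \<omega>2 y S n) * cube_integral (f_fun \<omega>1 \<omega>2 y S n')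
      + 2 * real CARD('k) * (1 + 2 * c') ^ (CARD('k) - 1) *
        (cube_integral (f_fun \<omega>1 \<omega>2 y S n) / real n ^ CARD('k) * real (gcd n n') ^ CARD('k) *
         (1 + (real n powr (\<tau> - 1 - 1 / real CARD('k)) + real n' powr (\<tau> - 1 - 1 / real CARD('k)))
            / (real (gcd n n') / (real n * real n'))) ^ (CARD('k) - 1))"
proof -
  let ?k = "CARD('k)"
  let ?f = "f_fun \<omega>1 \<omega>2 y S n"
  let ?f' = "f_fun \<omega>1 \<omega>2 y S n'"
  let ?J = "cube_integral (\<lambda>x. ?f x * ?f' (x + \<gamma>))"
  define e where "e m = real m powr (\<tau> - 1 - 1 / real ?k)" for m
  define h where "h = real (gcd n n') / (real n * real n')"
  define V where "V = core_volume S n'"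
  have h: "0 < h" using n by (simp add: h_def)
  have L: "0 \<le> cube_integral ?f" "0 \<le> cube_integral ?f'"
    using f_fun_bounds(1)[OF bumps adm] n by (auto intro: cube_integral_nonneg)
  have "real n ^ ?k * ?J \<le> cube_integral ?f * ((2 * real n * real n') ^ ?k * V +
      real (gcd n n') ^ ?k * (2 * real ?k * (2 * (c' * e n') / h + 1) ^ (?k - 1)))"
    unfolding e_def h_def V_def
    by (intro cube_integral_correlation_le[OF bumps adm n] sum_integer_shifts_le[OF bumps adm c' n])
  then have "?J \<le> cube_integral ?f * ((2 * real n * real n') ^ ?k * V +
      real (gcd n n') ^ ?k * (2 * real ?k * (2 * (c' * e n') / h + 1) ^ (?k - 1))) / real n ^ ?k"
    using n by (simp add: field_simps)
  also have "\<dots> = cube_integral ?f * (2 ^ ?k * (real n' ^ ?k * V)) +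
      2 * real ?k * (cube_integral ?f / real n ^ ?k * real (gcd n n') ^ ?k) * (2 * (c' * e n') / h + 1) ^ (?k - 1)"
    using n by (simp add: field_simps power_mult_distrib)
  \<comment> \<open>The core volume is replaced by its bound through the integral of
    \<open>?f'\<close>. In the error, \<open>e n\<close> is added although only \<open>e n'\<close>
    occurs, making the factor symmetric in \<open>n\<close> and \<open>n'\<close>.\<close>
  also have "\<dots> \<le> cube_integral ?f * ((2 / (\<delta> * l)) ^ ?k * cube_integral ?f') +
      2 * real ?k * (cube_integral ?f / real n ^ ?k * real (gcd n n') ^ ?k) *
        ((1 + 2 * c') * (1 + (e n + e n') / h)) ^ (?k - 1)"
  proof (intro add_mono mult_left_mono power_mono)
    have "real n' ^ ?k * V \<le> cube_integral ?f' / (\<delta> * l) ^ ?k"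
      using core_volume_le_cube_integral[OF bumps adm n(2) \<delta> l p] \<delta> l by (simp add: V_def field_simps)
    then have "2 ^ ?k * (real n' ^ ?k * V) \<le> 2 ^ ?k * (cube_integral ?f' / (\<delta> * l) ^ ?k)"
      by (rule mult_left_mono) simp
    then show "2 ^ ?k * (real n' ^ ?k * V) \<le> (2 / (\<delta> * l)) ^ ?k * cube_integral ?f'"
      by (simp add: power_divide)
    have "0 \<le> e n / h" "0 \<le> e n' / h" using h by (auto simp: e_def)
    then have "0 \<le> c' * (e n / h)" "0 \<le> c' * (e n' / h)" using c' by (intro mult_nonneg_nonneg; simp)+
    then have "2 * (c' * (e n' / h)) + 1 \<le> 1 + (e n / h + e n' / h) + 2 * c' + 2 * (c' * (e n / h)) + 2 * (c' * (e n' / h))"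
      using \<open>0 \<le> e n / h\<close> \<open>0 \<le> e n' / h\<close> c' by linarith
    then show "2 * (c' * e n') / h + 1 \<le> (1 + 2 * c') * (1 + (e n + e n') / h)"
      by (simp add: algebra_simps add_divide_distrib)
    show "0 \<le> 2 * (c' * e n') / h + 1"
      using h c' by (auto simp: e_def)
  qed (use L in auto)
  finally show ?thesis
    by (simp add: e_def h_def power_mult_distrib mult_ac)
qed

section \<open>Choice of the constants and symmetrization\<close>

theorem mainTheorem14:
  fixes \<omega>1 \<omega>2 :: "real \<Rightarrow> real"
  assumes "bump_function {t. \<bar>t\<bar> < 1} \<omega>1"
    and "bump_function {t. 1 / 2 \<le> \<bar>t\<bar> \<and> \<bar>t\<bar> < 1} \<omega>2"
  shows "\<exists>C>0. \<forall>\<tau> c c'. 0 < \<tau> \<and> \<tau> < 1 / real CARD('k) \<and> 0 < c \<and> 0 < c' \<longrightarrow>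
    (\<exists>K>0. \<forall>(\<psi> :: nat \<Rightarrow> real) (y :: real ^ 'k) (S :: 'k set_system).
       (\<forall>n\<ge>1. 0 \<le> \<psi> n \<and> \<psi> n < 1) \<and> admissible \<tau> c c' y S \<longrightarrow>
       (\<forall>n\<ge>1. \<forall>n'\<ge>1. \<forall>\<gamma> :: real ^ 'k.
          cube_integral (\<lambda>x. f_fun \<omega>1 \<omega>2 y S n x * f_fun \<omega>1 \<omega>2 y S n' (x + \<gamma>))
          \<le> C * cube_integral (f_fun \<omega>1 \<omega>2 y S n) * cube_integral (f_fun \<omega>1 \<omega>2 y S n')
             + K * error_term (f_fun \<omega>1 \<omega>2 y S n) (f_fun \<omega>1 \<omega>2 y S n') \<tau> n n'))"
proof -
  obtain \<delta>1 p1 l1 where 1: "0 < \<delta>1" "0 < l1" "\<And>t. p1 \<le> t \<Longrightarrow> t \<le> p1 + l1 \<Longrightarrow> \<delta>1 \<le> \<omega>1 t"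
    using bump_ge_on_interval[OF assms(1)] by metis
  obtain \<delta>2 p2 l2 where 2: "0 < \<delta>2" "0 < l2" "\<And>t. p2 \<le> t \<Longrightarrow> t \<le> p2 + l2 \<Longrightarrow> \<delta>2 \<le> \<omega>2 t"
    using bump_ge_on_interval[OF assms(2)] by metis
  \<comment> \<open>Minima over the two bump functions make one pair serve both interval types. Thus
    \<open>C\<close> depends only on the dimension and the bumps, and is fixed before \<tau>,
    \<open>c\<close> and \<open>c'\<close>.\<close>
  define \<delta> l where "\<delta> = min \<delta>1 \<delta>2" and "l = min l1 l2"
  define p where "p T = (case T of First_Type \<Rightarrow> p1 | Second_Type \<Rightarrow> p2)" for T
  have \<delta>: "0 < \<delta>" and l: "0 < l" using 1 2 by (auto simp: \<delta>_def l_def)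
  have p: "\<delta> \<le> bump_of \<omega>1 \<omega>2 T t" if t: "p T \<le> t" "t \<le> p T + l" for T t
  proof -
    have le: "\<delta> \<le> \<delta>1" "\<delta> \<le> \<delta>2" "l \<le> l1" "l \<le> l2"
      by (simp_all add: \<delta>_def l_def)
    show ?thesis
    proof (cases T)
      case First_Type
      then show ?thesis using t le 1(3)[of t] by (simp add: p_def bump_of_def)
    next
      case Second_Type
      then show ?thesis using t le 2(3)[of t] by (simp add: p_def bump_of_def)
    qed
  qed
  define C where "C = (2 / (\<delta> * l)) ^ CARD('k)"
  have C: "0 < C" using \<delta> l by (simp add: C_def)
  have "\<exists>K>0. \<forall>(\<psi> :: nat \<Rightarrow> real) (y :: real ^ 'k) (S :: 'k set_system).
       (\<forall>n\<ge>1. 0 \<le> \<psi> n \<and> \<psi> n < 1) \<and> admissible \<tau> c c' y S \<longrightarrow>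
       (\<forall>n\<ge>1. \<forall>n'\<ge>1. \<forall>\<gamma> :: real ^ 'k.
          cube_integral (\<lambda>x. f_fun \<omega>1 \<omega>2 y S n x * f_fun \<omega>1 \<omega>2 y S n' (x + \<gamma>))
          \<le> C * cube_integral (f_fun \<omega>1 \<omega>2 y S n) * cube_integral (f_fun \<omega>1 \<omega>2 y S n')
             + K * error_term (f_fun \<omega>1 \<omega>2 y S n) (f_fun \<omega>1 \<omega>2 y S n') \<tau> n n')"
    if c': "0 < c'" for \<tau> c c'
  proof -
    define K where "K = 2 * real CARD('k) * (1 + 2 * c') ^ (CARD('k) - 1)"
    have K: "0 < K" using c' by (simp add: K_def)
    have "cube_integral (\<lambda>x. f_fun \<omega>1 \<omega>2 y S n x * f_fun \<omega>1 \<omega>2 y S n' (x + \<gamma>))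
          \<le> C * cube_integral (f_fun \<omega>1 \<omega>2 y S n) * cube_integral (f_fun \<omega>1 \<omega>2 y S n')
             + K * error_term (f_fun \<omega>1 \<omega>2 y S n) (f_fun \<omega>1 \<omega>2 y S n') \<tau> n n'"
      if adm: "admissible \<tau> c c' y S" and n: "1 \<le> n" "1 \<le> n'"
      for y :: "real ^ 'k" and S :: "'k set_system" and n n' and \<gamma> :: "real ^ 'k"
    proof -
      let ?f = "f_fun \<omega>1 \<omega>2 y S n"
      let ?f' = "f_fun \<omega>1 \<omega>2 y S n'"
      let ?J = "cube_integral (\<lambda>x. ?f x * ?f' (x + \<gamma>))"
      let ?L = "cube_integral ?f" and ?L' = "cube_integral ?f'"
      define G where "G = real (gcd n n') ^ CARD('k) *
         (1 + (real n powr (\<tau> - 1 - 1 / real CARD('k)) + real n' powr (\<tau> - 1 - 1 / real CARD('k)))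
            / (real (gcd n n') / (real n * real n'))) ^ (CARD('k) - 1)"
      note [measurable] = f_fun_measurable[OF assms adm n(1)] f_fun_measurable[OF assms adm n(2)]
      have le1: "?J \<le> C * ?L * ?L' + K * (?L / real n ^ CARD('k) * G)"
        using cube_integral_correlation_one_sided[OF assms \<delta> l p adm c' n, where \<gamma> = \<gamma>]
        by (simp add: C_def K_def G_def mult.assoc)
      \<comment> \<open>Translation by -\<gamma> exchanges the two functions, so the one-sided
        estimate also holds with the other integral in its error.\<close>
      have "?J = cube_integral (\<lambda>x. ?f' x * ?f (x + - \<gamma>))"
      proof -
        have "cube_integral (\<lambda>x. ?f' (x + \<gamma>) * ?f (x + \<gamma> + - \<gamma>)) = cube_integral (\<lambda>x. ?f' x * ?f (x + - \<gamma>))"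
        proof (rule cube_integral_shift[where B = 1])
          show "?f' (x + int_vec a) * ?f (x + int_vec a + - \<gamma>) = ?f' x * ?f (x + - \<gamma>)" for x a
            using f_fun_periodic_int[OF assms adm n(1), of "x + - \<gamma>" a] f_fun_periodic_int[OF assms adm n(2), of x a]
            by (simp add: algebra_simps)
          show "0 \<le> ?f' x * ?f (x + - \<gamma>)" "?f' x * ?f (x + - \<gamma>) \<le> 1" for x
            using f_fun_bounds[OF assms adm n(1)] f_fun_bounds[OF assms adm n(2)] by (auto intro: mult_le_one)
        qed measurable
        then show ?thesis by (simp add: mult.commute)
      qed
      also have "\<dots> \<le> C * ?L * ?L' + K * (?L' / real n' ^ CARD('k) * G)"
        using cube_integral_correlation_one_sided[OF assms \<delta> l p adm c' n(2,1), where \<gamma> = "- \<gamma>"]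
        by (simp add: C_def K_def G_def gcd.commute ac_simps)
      finally have le2: "?J \<le> C * ?L * ?L' + K * (?L' / real n' ^ CARD('k) * G)" .
      have "error_term ?f ?f' \<tau> n n' = min (?L / real n ^ CARD('k)) (?L' / real n' ^ CARD('k)) * G"
        by (simp add: error_term_def G_def mult.assoc)
      \<comment> \<open>The two bounds share the main term, \<open>K\<close> and \<open>G\<close>,
        so the smaller of the two errors may be taken.\<close>
      then show ?thesis using le1 le2 by (simp add: min_def)
    qed
    then show ?thesis using K by blast
  qed
  then show ?thesis using C by blast
qed

end
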